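(* Let $r>0$, let $X$ be a sequentially complete Hausdorff locally convex space and $(T(t))_{t\geq 0}$ a strongly continuous locally equicontinuous semigroup on $X$ with generator $A$. Let $U$ be a Hausdorff locally convex space and $B\in\mathcal{L}(U;X)$. Consider the following assertions. (a) $(T(t))_{t\geq 0}$ satisfies $\mathrm{C}$-maximal regularity for $(B,r)$. (b) For all $f\in \mathrm{C}([0,r];U)$: $(T\ast Bf)(t)\in D(A)$ for all $t\in [0,r]$ and $A(T\ast Bf)$ is right-continuous on $[0,r]$. (c) $(T\ast Bf)(r)\in D(A)$ for all $f\in\mathrm{C}([0,r];U)$. (d) $(T(t)B)_{t\in [0,r]}$ is of bounded semivariation. Then (a)$\Rightarrow$(b) and (d)$\Rightarrow$(b)$\Rightarrow$(c). If $X$ is a $3\mathrm{C}_{U,A,r}^{B}$-space, then (c)$\Rightarrow$(d). If (i) $U$ is an invariant subspace of $X$ with respect to $(T(t))_{t\geq 0}$ and $B$ is commuting with $(T(t))_{t\geq 0}$, or (ii) $X$ is a generalised Schwartz space, then (d)$\Rightarrow$(a).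
   Context: All spaces are over $\mathbb{K}=\mathbb{R}$ or $\mathbb{C}$. For a Hausdorff locally convex space $X$, $\Gamma_X$ denotes a fundamental system of seminorms (a family of continuous seminorms such that every continuous seminorm $q$ on $X$ satisfies $q\le Cp$ for some $p\in\Gamma_X$, $C\ge 0$). $\mathcal{L}(X;Y)$ is the space of continuous linear maps, $\mathcal{L}(X)=\mathcal{L}(X;X)$. $\mathrm{C}([0,r];X)$ is the space of continuous functions $[0,r]\to X$ with the topology of the seminorms $\|f\|_p=\sup_{s\in[0,r]}p(f(s))$, $p\in\Gamma_X$. A family $(T(t))_{t\ge0}$ in $\mathcal{L}(X)$ is a semigroup if $T(0)=\mathrm{id}$ and $T(t+s)=T(t)T(s)$; strongly continuous if $t\mapsto T(t)x$ is continuous on $[0,\infty)$ for all $x\in X$; locally equicontinuous if for all $q\in\Gamma_X$, $t_0\ge0$ there are $p\in\Gamma_X$, $C\ge0$ with $q(T(t)x)\le Cp(x)$ for all $t\in[0,t_0]$, $x\in X$. Its generator is $Ax=\lim_{t\to0+}\frac{T(t)x-x}{t}$ with domain $D(A)$ the set of $x\in X$ for which this limit exists in $X$. For $g\in\mathrm{C}([0,r];X)$ the convolution is $(T\ast g)(t)=\int_0^tT(t-s)g(s)\,\mathrm{d}s$, $t\in[0,r]$ (Riemann integral in $X$, which exists). $Bf$ denotes $s\mapsto Bf(s)$. $\mathrm{C}$-maximal regularity for $(B,r)$: for all $f\in\mathrm{C}([0,r];U)$ one has $(T\ast Bf)(t)\in D(A)$ for all $t\in[0,r]$ and $A(T\ast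 Bf)\in\mathrm{C}([0,r];X)$. Bounded semivariation: for $\alpha\colon[a,b]\to\mathcal{L}(U;X)$, $q\in\Gamma_X$, $p\in\Gamma_U$, let $SV_{q,p}(\alpha)$ be the supremum of $q\bigl(\sum_{i=1}^n(\alpha(d_i)-\alpha(d_{i-1}))x_i\bigr)$ over all partitions $a=d_0<d_1<\dots<d_n=b$ and all $x_1,\dots,x_n\in U$ with $p(x_i)\le1$. $\alpha$ is of bounded semivariation if for every $q\in\Gamma_X$ there is $p\in\Gamma_U$ with $SV_{q,p}(\alpha)<\infty$. $(T(t)B)_{t\in[0,r]}$ is of bounded semivariation if $[0,r]\ni t\mapsto T(t)B\in\mathcal{L}(U;X)$ is. $3\mathrm{C}_{U,A,r}^{B}$-space: suppose $\Psi_r^B(f):=(T\ast Bf)(r)\in D(A)$ for all $f\in\mathrm{C}([0,r];U)$. Then $X$ is called a $3\mathrm{C}_{U,A,r}^{B}$-space if the (closed) linear map $A\Psi_r^B\colon\mathrm{C}([0,r];U)\to X$ is continuous. $U$ is an invariant subspace of $X$ w.r.t. the semigroup if $U$ is a topological linear subspace of $X$ (carrying the induced topology) and $T(t)x\in U$ for all $t\ge0$, $x\in U$; then $B\in\mathcal{L}(U;X)$ is commuting with $(T(t))_{t\ge0}$ if $T(t)Bx=BT(t)x$ for all $t\ge0$, $x\in U$. $X$ is a generalised Schwartz space if every bounded subset of $X$ is precompact. *)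

theory Defs
  imports "HOL-Analysis.Analysis"
begin

text \<open>
  The scalar field is a type \<open>'k\<close> of class \<^class>\<open>real_normed_field\<close>: \<^typ>\<open>real\<close> and \<^typ>\<open>complex\<close>
  are instances and, by Gelfand--Mazur, every instance is isomorphic to one of them.  A
  locally convex space is a type carrying an additive group and a topology, together with its
  scalar multiplication; Hausdorff is the class \<^class>\<open>t2_space\<close>.  Real scalars act through
  \<^const>\<open>of_real\<close>.
\<close>

subsection \<open>Locally convex spaces\<close>

definition seminorm :: "('k::real_normed_field \<Rightarrow> 'x::ab_group_add \<Rightarrow> 'x) \<Rightarrow> ('x \<Rightarrow> real) \<Rightarrow> bool" where
  "seminorm sX p \<longleftrightarrow>
     (\<forall>x y. p (x + y) \<le> p x + p y) \<and> (\<forall>a x. p (sX a x) = norm a * p x)"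

definition continuous_seminorm ::
    "('k::real_normed_field \<Rightarrow> 'x::{ab_group_add,topological_space} \<Rightarrow> 'x) \<Rightarrow> ('x \<Rightarrow> real) \<Rightarrow> bool" where
  "continuous_seminorm sX p \<longleftrightarrow> seminorm sX p \<and> continuous_on UNIV p"

text \<open>The topology is the one generated by the continuous seminorms.\<close>

definition locally_convex_space ::
    "('k::real_normed_field \<Rightarrow> 'x::{ab_group_add,topological_space} \<Rightarrow> 'x) \<Rightarrow> bool" where
  "locally_convex_space sX \<longleftrightarrow>
     vector_space sX \<and>
     (\<forall>S. open S \<longleftrightarrow>
        (\<forall>x\<in>S. \<exists>p e. continuous_seminorm sX p \<and> e > 0 \<and> {y. p (y - x) < e} \<subseteq> S))"

definition fundamental_system ::
    "('k::real_normed_field \<Rightarrow> 'x::{ab_group_add,topological_space} \<Rightarrow> 'x) \<Rightarrow> ('x \<Rightarrow> real) set \<Rightarrow> bool" where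
  "fundamental_system sX \<Gamma> \<longleftrightarrow>
     (\<forall>p\<in>\<Gamma>. continuous_seminorm sX p) \<and>
     (\<forall>q. continuous_seminorm sX q \<longrightarrow> (\<exists>p\<in>\<Gamma>. \<exists>C\<ge>0. \<forall>x. q x \<le> C * p x))"

definition seq_complete :: "'x::{ab_group_add,topological_space} itself \<Rightarrow> bool" where
  "seq_complete _ \<longleftrightarrow>
     (\<forall>x :: nat \<Rightarrow> 'x.
        (\<forall>V. open V \<and> 0 \<in> V \<longrightarrow> (\<exists>N. \<forall>m\<ge>N. \<forall>n\<ge>N. x m - x n \<in> V)) \<longrightarrow> convergent x)"

definition lcs_bounded :: "('x \<Rightarrow> real) set \<Rightarrow> 'x set \<Rightarrow> bool" where
  "lcs_bounded \<Gamma> S \<longleftrightarrow> (\<forall>p\<in>\<Gamma>. \<exists>C. \<forall>x\<in>S. p x \<le> C)"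

definition precompact :: "'x::{ab_group_add,topological_space} set \<Rightarrow> bool" where
  "precompact S \<longleftrightarrow>
     (\<forall>V. open V \<and> 0 \<in> V \<longrightarrow> (\<exists>F. finite F \<and> S \<subseteq> (\<Union>x\<in>F. {x + v | v. v \<in> V})))"

definition generalised_Schwartz :: "('x::{ab_group_add,topological_space} \<Rightarrow> real) set \<Rightarrow> bool" where
  "generalised_Schwartz \<Gamma> \<longleftrightarrow> (\<forall>S. lcs_bounded \<Gamma> S \<longrightarrow> precompact S)"

definition continuous_linear ::
    "('k::real_normed_field \<Rightarrow> 'u::{ab_group_add,topological_space} \<Rightarrow> 'u) \<Rightarrow>
     ('k \<Rightarrow> 'x::{ab_group_add,topological_space} \<Rightarrow> 'x) \<Rightarrow> ('u \<Rightarrow> 'x) \<Rightarrow> bool" where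
  "continuous_linear sU sX L \<longleftrightarrow> Vector_Spaces.linear sU sX L \<and> continuous_on UNIV L"

subsection \<open>Semigroups; only the values at times \<open>t \<ge> 0\<close> matter\<close>

definition operator_semigroup ::
    "('k::real_normed_field \<Rightarrow> 'x::{ab_group_add,topological_space} \<Rightarrow> 'x) \<Rightarrow> (real \<Rightarrow> 'x \<Rightarrow> 'x) \<Rightarrow> bool" where
  "operator_semigroup sX T \<longleftrightarrow>
     (\<forall>t\<ge>0. continuous_linear sX sX (T t)) \<and> T 0 = id \<and>
     (\<forall>t\<ge>0. \<forall>s\<ge>0. T (t + s) = T t \<circ> T s)"

definition strongly_continuous :: "(real \<Rightarrow> 'x \<Rightarrow> 'x::topological_space) \<Rightarrow> bool" where
  "strongly_continuous T \<longleftrightarrow> (\<forall>x. continuous_on {0..} (\<lambda>t. T t x))"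

definition locally_equicontinuous :: "('x \<Rightarrow> real) set \<Rightarrow> (real \<Rightarrow> 'x \<Rightarrow> 'x) \<Rightarrow> bool" where
  "locally_equicontinuous \<Gamma> T \<longleftrightarrow>
     (\<forall>q\<in>\<Gamma>. \<forall>t0\<ge>0. \<exists>p\<in>\<Gamma>. \<exists>C\<ge>0. \<forall>t\<in>{0..t0}. \<forall>x. q (T t x) \<le> C * p x)"

definition diff_quotient ::
    "('k::real_normed_field \<Rightarrow> 'x::ab_group_add \<Rightarrow> 'x) \<Rightarrow> (real \<Rightarrow> 'x \<Rightarrow> 'x) \<Rightarrow> 'x \<Rightarrow> real \<Rightarrow> 'x" where
  "diff_quotient sX T x t = sX (of_real (1 / t)) (T t x - x)"

definition gen_domain ::
    "('k::real_normed_field \<Rightarrow> 'x::{ab_group_add,t2_space} \<Rightarrow> 'x) \<Rightarrow> (real \<Rightarrow> 'x \<Rightarrow> 'x) \<Rightarrow> 'x set" where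
  "gen_domain sX T = {x. \<exists>y. (diff_quotient sX T x \<longlongrightarrow> y) (at_right 0)}"

text \<open>Meaningful on \<^const>\<open>gen_domain\<close> only.\<close>

definition gen ::
    "('k::real_normed_field \<Rightarrow> 'x::{ab_group_add,t2_space} \<Rightarrow> 'x) \<Rightarrow> (real \<Rightarrow> 'x \<Rightarrow> 'x) \<Rightarrow> 'x \<Rightarrow> 'x" where
  "gen sX T x = Lim (at_right 0) (diff_quotient sX T x)"

subsection \<open>Riemann integral and convolution\<close>

text \<open>
  The library's \<open>has_integral\<close> needs a normed space.  Using only constant gauges
  \<open>\<lambda>x. ball x \<delta>\<close> makes this the Riemann (not the Henstock--Kurzweil) integral.
\<close>

definition has_riemann_integral ::
    "('k::real_normed_field \<Rightarrow> 'x::{ab_group_add,topological_space} \<Rightarrow> 'x) \<Rightarrow>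
     (real \<Rightarrow> 'x) \<Rightarrow> 'x \<Rightarrow> real \<Rightarrow> real \<Rightarrow> bool" where
  "has_riemann_integral sX g y a b \<longleftrightarrow>
     (\<forall>V. open V \<and> y \<in> V \<longrightarrow>
        (\<exists>\<delta>>0. \<forall>D. D tagged_division_of {a..b} \<and> (\<lambda>x. ball x \<delta>) fine D \<longrightarrow>
           (\<Sum>(x, K)\<in>D. sX (of_real (measure lborel K)) (g x)) \<in> V))"

definition riemann_integral ::
    "('k::real_normed_field \<Rightarrow> 'x::{ab_group_add,t2_space} \<Rightarrow> 'x) \<Rightarrow> real \<Rightarrow> real \<Rightarrow> (real \<Rightarrow> 'x) \<Rightarrow> 'x" where
  "riemann_integral sX a b g = (THE y. has_riemann_integral sX g y a b)"

definition convolution ::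
    "('k::real_normed_field \<Rightarrow> 'x::{ab_group_add,t2_space} \<Rightarrow> 'x) \<Rightarrow> (real \<Rightarrow> 'x \<Rightarrow> 'x) \<Rightarrow>
     (real \<Rightarrow> 'x) \<Rightarrow> real \<Rightarrow> 'x" where
  "convolution sX T g t = riemann_integral sX 0 t (\<lambda>s. T (t - s) (g s))"

subsection \<open>The space of continuous functions on \<open>[0,r]\<close>\<close>

text \<open>A function on \<open>[0,r]\<close> is a total function that is \<^const>\<open>undefined\<close> off \<open>[0,r]\<close>.\<close>

definition C_space :: "real \<Rightarrow> (real \<Rightarrow> 'u::topological_space) set" where
  "C_space r = {f \<in> extensional {0..r}. continuous_on {0..r} f}"

definition sup_seminorm :: "real \<Rightarrow> ('u \<Rightarrow> real) \<Rightarrow> (real \<Rightarrow> 'u) \<Rightarrow> real" where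
  "sup_seminorm r p f = (SUP s\<in>{0..r}. p (f s))"

definition C_topology :: "real \<Rightarrow> ('u::{ab_group_add,topological_space} \<Rightarrow> real) set \<Rightarrow> (real \<Rightarrow> 'u) topology" where
  "C_topology r \<Gamma> = topology_generated_by
     {{g \<in> C_space r. sup_seminorm r p (\<lambda>s. g s - f s) < e} | f p e. f \<in> C_space r \<and> p \<in> \<Gamma> \<and> e > 0}"

subsection \<open>Maximal regularity, semivariation, 3C-spaces, invariant subspaces\<close>

definition C_maximal_regularity ::
    "('k::real_normed_field \<Rightarrow> 'x::{ab_group_add,t2_space} \<Rightarrow> 'x) \<Rightarrow> (real \<Rightarrow> 'x \<Rightarrow> 'x) \<Rightarrow>
     ('u::topological_space \<Rightarrow> 'x) \<Rightarrow> real \<Rightarrow> bool" where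
  "C_maximal_regularity sX T B r \<longleftrightarrow>
     (\<forall>f\<in>C_space r.
        (\<forall>t\<in>{0..r}. convolution sX T (\<lambda>s. B (f s)) t \<in> gen_domain sX T) \<and>
        continuous_on {0..r} (\<lambda>t. gen sX T (convolution sX T (\<lambda>s. B (f s)) t)))"

definition semivariation ::
    "('x::ab_group_add \<Rightarrow> real) \<Rightarrow> ('u \<Rightarrow> real) \<Rightarrow> (real \<Rightarrow> 'u \<Rightarrow> 'x) \<Rightarrow> real \<Rightarrow> real \<Rightarrow> ereal" where
  "semivariation q p \<alpha> a b =
     Sup {ereal (q (\<Sum>i<n. \<alpha> (d (Suc i)) (x i) - \<alpha> (d i) (x i))) | n d x.
            d 0 = a \<and> d n = b \<and> (\<forall>i<n. d i < d (Suc i)) \<and> (\<forall>i<n. p (x i) \<le> 1)}"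

definition bounded_semivariation ::
    "('x::ab_group_add \<Rightarrow> real) set \<Rightarrow> ('u \<Rightarrow> real) set \<Rightarrow> (real \<Rightarrow> 'u \<Rightarrow> 'x) \<Rightarrow> real \<Rightarrow> real \<Rightarrow> bool" where
  "bounded_semivariation \<Gamma>X \<Gamma>U \<alpha> a b \<longleftrightarrow>
     (\<forall>q\<in>\<Gamma>X. \<exists>p\<in>\<Gamma>U. semivariation q p \<alpha> a b < \<infinity>)"

definition right_continuous_regularity ::
    "('k::real_normed_field \<Rightarrow> 'x::{ab_group_add,t2_space} \<Rightarrow> 'x) \<Rightarrow> (real \<Rightarrow> 'x \<Rightarrow> 'x) \<Rightarrow>
     ('u::topological_space \<Rightarrow> 'x) \<Rightarrow> real \<Rightarrow> bool" where
  "right_continuous_regularity sX T B r \<longleftrightarrow>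
     (\<forall>f\<in>C_space r.
        (\<forall>t\<in>{0..r}. convolution sX T (\<lambda>s. B (f s)) t \<in> gen_domain sX T) \<and>
        (\<forall>t\<in>{0..r}. continuous (at t within {t..r})
           (\<lambda>t. gen sX T (convolution sX T (\<lambda>s. B (f s)) t))))"

definition Psi ::
    "('k::real_normed_field \<Rightarrow> 'x::{ab_group_add,t2_space} \<Rightarrow> 'x) \<Rightarrow> (real \<Rightarrow> 'x \<Rightarrow> 'x) \<Rightarrow>
     ('u \<Rightarrow> 'x) \<Rightarrow> real \<Rightarrow> (real \<Rightarrow> 'u) \<Rightarrow> 'x" where
  "Psi sX T B r f = convolution sX T (\<lambda>s. B (f s)) r"

definition endpoint_regularity ::
    "('k::real_normed_field \<Rightarrow> 'x::{ab_group_add,t2_space} \<Rightarrow> 'x) \<Rightarrow> (real \<Rightarrow> 'x \<Rightarrow> 'x) \<Rightarrow>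
     ('u::topological_space \<Rightarrow> 'x) \<Rightarrow> real \<Rightarrow> bool" where
  "endpoint_regularity sX T B r \<longleftrightarrow> (\<forall>f\<in>C_space r. Psi sX T B r f \<in> gen_domain sX T)"

definition threeC_space ::
    "('k::real_normed_field \<Rightarrow> 'x::{ab_group_add,t2_space} \<Rightarrow> 'x) \<Rightarrow> (real \<Rightarrow> 'x \<Rightarrow> 'x) \<Rightarrow>
     ('u::{ab_group_add,topological_space} \<Rightarrow> real) set \<Rightarrow> ('u \<Rightarrow> 'x) \<Rightarrow> real \<Rightarrow> bool" where
  "threeC_space sX T \<Gamma>U B r \<longleftrightarrow>
     endpoint_regularity sX T B r \<and>
     continuous_map (C_topology r \<Gamma>U) euclidean (\<lambda>f. gen sX T (Psi sX T B r f))"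

text \<open>
  As \<open>U\<close> and \<open>X\<close> are types, the inclusion of a topological linear subspace \<open>U\<close> into \<open>X\<close> is a
  linear map \<open>j\<close> that is a topological embedding.  \<open>T t\<close> acts on \<open>U\<close> as
  \<open>\<lambda>x. inv j (T t (j x))\<close>.
\<close>

definition invariant_subspace ::
    "('k::real_normed_field \<Rightarrow> 'u::{ab_group_add,topological_space} \<Rightarrow> 'u) \<Rightarrow>
     ('k \<Rightarrow> 'x::{ab_group_add,topological_space} \<Rightarrow> 'x) \<Rightarrow> (real \<Rightarrow> 'x \<Rightarrow> 'x) \<Rightarrow> ('u \<Rightarrow> 'x) \<Rightarrow> bool" where
  "invariant_subspace sU sX T j \<longleftrightarrow>
     Vector_Spaces.linear sU sX j \<and> embedding_map euclidean euclidean j \<and>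
     (\<forall>t\<ge>0. \<forall>x\<in>range j. T t x \<in> range j)"

definition commuting :: "(real \<Rightarrow> 'x \<Rightarrow> 'x) \<Rightarrow> ('u \<Rightarrow> 'x) \<Rightarrow> ('u \<Rightarrow> 'x) \<Rightarrow> bool" where
  "commuting T j B \<longleftrightarrow> (\<forall>t\<ge>0. \<forall>x. T t (B x) = B (inv j (T t (j x))))"

end

theory Submission
  imports Defs
begin

text \<open>
  For a step function \<open>f\<close> the convolution \<open>T * Bf\<close> is a finite sum of integrals of orbits, so
  \<open>A (T * Bf)(t)\<close> is an explicit finite sum of differences \<open>T(u) B x - T(v) B x\<close>.  This sum is
  continuous in \<open>t\<close> and, uniformly in \<open>t \<le> r\<close>, bounded by the semivariation times the supremum
  of \<open>f\<close>.  Hence if \<open>(T(t) B)\<close> has bounded semivariation, step functions approximating a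
  continuous \<open>f\<close> give generator values that converge uniformly in \<open>t\<close>, and as \<open>A\<close> is closed,
  \<open>T * Bf\<close> maps into the domain with \<open>A (T * Bf)\<close> continuous: (d) implies (a) outright.

  Conversely, let \<open>f\<close> be a step function realising a semivariation sum \<open>A \<Psi> f\<close>, and let continuous
  trapezoidal functions \<open>g\<close> with the same bound tend to \<open>f\<close>.  In a 3C-space \<open>A \<Psi> g\<close> stays
  bounded, hence so do the difference quotients of \<open>\<Psi> g\<close>, being means of \<open>T(u) A \<Psi> g\<close>.  Letting
  first \<open>g\<close> tend to \<open>f\<close> and then the step of the quotient tend to \<open>0\<close> bounds \<open>A \<Psi> f\<close>.
\<close>

section \<open>Seminorms and convergence\<close>

text \<open>Partitions are taken in elapsed time \<open>t - u\<close>: the orbit integral over the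
  interval where elapsed time runs from \<open>a\<close> to \<open>b\<close> has generator value
  \<open>T(b) z - T(a) z\<close>, so a partition of elapsed time reproduces a semivariation sum
  exactly. One grid serves all \<open>t\<close> and is cut off at \<open>t\<close>; cut-off nodes
  coincide and the last node may lie before \<open>r\<close>, so the variation bound must cover weak
  partitions that stop early. Two step approximations can be compared only on a common partition,
  whence the product grid \<open>n * m\<close>: the sampling errors of \<open>f\<close> then become
  the coefficients of a single variation sum. For the converse, a bound on the coefficients must
  pass to the continuous approximants without a factor that grows with the number of intervals. This
  forces bumps that vanish at both ends of their interval, so that at most one of them is nonzero at
  any point.\<close>

lemma continuous_linear_hom:
  "continuous_linear sU sX L \<Longrightarrow> module_hom sU sX L"
  by (simp add: continuous_linear_def linear_iff_module_hom)

lemma continuous_seminorm_comp: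
  assumes "continuous_linear sU sX L" "continuous_seminorm sX p"
  shows "continuous_seminorm sU (\<lambda>x. p (L x))"
proof -
  interpret module_hom sU sX L
    by (rule continuous_linear_hom) fact
  have "continuous_on UNIV L" "continuous_on UNIV p"
    using assms by (auto simp: continuous_linear_def continuous_seminorm_def)
  then have "continuous_on UNIV (\<lambda>x. p (L x))"
    using continuous_on_compose2 by blast
  then show ?thesis
    using assms by (auto simp: continuous_seminorm_def seminorm_def add scale)
qed

lemma continuous_linear_tendsto:
  assumes "continuous_linear sU sX L" "(f \<longlongrightarrow> l) F"
  shows "((\<lambda>x. L (f x)) \<longlongrightarrow> L l) F"
  using assms continuous_on_tendsto_compose[of UNIV L f l F] by (simp add: continuous_linear_def)

locale lcs = vector_space s
  for s :: "'k::real_normed_field \<Rightarrow> 'x::{ab_group_add,t2_space} \<Rightarrow> 'x" +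
  assumes open_iff: "open S \<longleftrightarrow>
        (\<forall>x\<in>S. \<exists>p e. continuous_seminorm s p \<and> e > 0 \<and> {y. p (y - x) < e} \<subseteq> S)"
begin

abbreviation cs where "cs \<equiv> continuous_seminorm s"

lemma cs_triangle: "cs p \<Longrightarrow> p (x + y) \<le> p x + p y"
  and cs_scale: "cs p \<Longrightarrow> p (s a x) = norm a * p x"
  by (auto simp: continuous_seminorm_def seminorm_def)

lemma cs_zero: "cs p \<Longrightarrow> p 0 = 0"
  using cs_scale[of p 0 0] by simp

lemma cs_minus: "cs p \<Longrightarrow> p (- x) = p x"
  using cs_scale[of p "-1" x] by simp

lemma cs_diff_commute: "cs p \<Longrightarrow> p (x - y) = p (y - x)"
  using cs_minus[of p "x - y"] by simp

lemma cs_nonneg: "cs p \<Longrightarrow> 0 \<le> p x"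
  using cs_triangle[of p x "- x"] cs_minus[of p x] cs_zero[of p] by simp

lemma cs_triangle_diff: "cs p \<Longrightarrow> p (x - z) \<le> p (x - y) + p (y - z)"
  using cs_triangle[of p "x - y" "y - z"] by simp

lemma cs_diff_le: "cs p \<Longrightarrow> p (x - y) \<le> p x + p y"
  using cs_triangle[of p "x" "- y"] by (simp add: cs_minus)

lemma cs_sum_le: "cs p \<Longrightarrow> p (\<Sum>i\<in>I. f i) \<le> (\<Sum>i\<in>I. p (f i))"
proof (induction I rule: infinite_finite_induct)
  case (insert i I)
  then show ?case
    using cs_triangle[of p "f i" "sum f I"] by simp
qed (auto simp: cs_zero)

lemma cs_add: "cs p \<Longrightarrow> cs q \<Longrightarrow> cs (\<lambda>x. p x + q x)"
  unfolding continuous_seminorm_def seminorm_def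
proof safe
  fix x y assume "\<forall>x y. p (x + y) \<le> p x + p y" "\<forall>x y. q (x + y) \<le> q x + q y"
  then have "p (x + y) \<le> p x + p y" "q (x + y) \<le> q x + q y"
    by blast+
  then show "p (x + y) + q (x + y) \<le> p x + q x + (p y + q y)"
    by linarith
qed (auto intro: continuous_on_add simp: distrib_left)

lemma cs_cmult: "cs p \<Longrightarrow> 0 \<le> c \<Longrightarrow> cs (\<lambda>x. c * p x)"
  unfolding continuous_seminorm_def seminorm_def
  by (auto intro!: continuous_intros simp: mult_left_mono simp flip: distrib_left)

lemma open_cs_ball:
  assumes "cs p"
  shows "open {y. p (y - x) < e}"
  unfolding open_iff
proof
  fix z assume z: "z \<in> {y. p (y - x) < e}"
  have "{y. p (y - z) < e - p (z - x)} \<subseteq> {y. p (y - x) < e}"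
  proof safe
    fix y assume "p (y - z) < e - p (z - x)"
    then show "p (y - x) < e"
      using cs_triangle_diff[OF assms, of y x z] by linarith
  qed
  with z assms show "\<exists>q d. cs q \<and> 0 < d \<and> {y. q (y - z) < d} \<subseteq> {y. p (y - x) < e}"
    by (intro exI[of _ p] exI[of _ "e - p (z - x)"]) auto
qed

lemma tendsto_iff_cs:
  "(f \<longlongrightarrow> l) F \<longleftrightarrow> (\<forall>p e. cs p \<longrightarrow> e > 0 \<longrightarrow> (\<forall>\<^sub>F x in F. p (f x - l) < e))"
proof
  assume *: "(f \<longlongrightarrow> l) F"
  show "\<forall>p e. cs p \<longrightarrow> e > 0 \<longrightarrow> (\<forall>\<^sub>F x in F. p (f x - l) < e)"
    using topological_tendstoD[OF * open_cs_ball] by (auto simp: cs_zero)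
next
  assume *: "\<forall>p e. cs p \<longrightarrow> e > 0 \<longrightarrow> (\<forall>\<^sub>F x in F. p (f x - l) < e)"
  show "(f \<longlongrightarrow> l) F"
  proof (rule topological_tendstoI)
    fix S assume "open S" "l \<in> S"
    then obtain p e where "cs p" "e > 0" "{y. p (y - l) < e} \<subseteq> S"
      unfolding open_iff by blast
    then show "\<forall>\<^sub>F x in F. f x \<in> S"
      using eventually_mono[of "\<lambda>x. p (f x - l) < e" F "\<lambda>x. f x \<in> S"] * by blast
  qed
qed

lemma tendstoI_cs:
  assumes "\<And>p e. cs p \<Longrightarrow> e > 0 \<Longrightarrow> \<forall>\<^sub>F x in F. p (f x - l) < e"
  shows "(f \<longlongrightarrow> l) F"
  using assms tendsto_iff_cs by blast

lemma tendstoD_cs: "(f \<longlongrightarrow> l) F \<Longrightarrow> cs p \<Longrightarrow> e > 0 \<Longrightarrow> \<forall>\<^sub>F x in F. p (f x - l) < e"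
  using tendsto_iff_cs by blast

lemma tendsto_cs: "cs p \<Longrightarrow> (f \<longlongrightarrow> l) F \<Longrightarrow> ((\<lambda>x. p (f x)) \<longlongrightarrow> p l) F"
  using continuous_on_tendsto_compose[of UNIV p f l F] by (simp add: continuous_seminorm_def)

text \<open>The type carries just a group and a topology, so continuity of the operations is derived
  from the generating seminorms and not from a type class.\<close>

lemma tendsto_add_cs:
  assumes "(f \<longlongrightarrow> (l::'x)) F" "(g \<longlongrightarrow> m) F"
  shows "((\<lambda>x. f x + g x) \<longlongrightarrow> l + m) F"
proof (rule tendstoI_cs)
  fix p and e :: real assume p: "cs p" and "e > 0"
  then have "\<forall>\<^sub>F x in F. p (f x - l) < e / 2" "\<forall>\<^sub>F x in F. p (g x - m) < e / 2"
    using assms[THEN tendstoD_cs, of p "e / 2"] by simp_all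
  then show "\<forall>\<^sub>F x in F. p (f x + g x - (l + m)) < e"
  proof eventually_elim
    case (elim x)
    then show ?case
      using cs_triangle[OF p, of "f x - l" "g x - m"] by (simp add: algebra_simps)
  qed
qed

lemma tendsto_scale_cs:
  assumes "(f \<longlongrightarrow> l) F" "(a \<longlongrightarrow> b) F"
  shows "((\<lambda>x. s (a x) (f x)) \<longlongrightarrow> s b l) F"
proof (rule tendstoI_cs)
  fix p and e :: real assume p: "cs p" and e: "e > 0"
  have "((\<lambda>x. norm (a x) * p (f x - l) + norm (a x - b) * p l) \<longlongrightarrow>
      norm b * p (0::'x) + norm (b - b) * p l) F"
  proof (intro tendsto_intros assms tendsto_cs p)
    show "((\<lambda>x. f x - l) \<longlongrightarrow> 0) F"
      using assms(1) by (simp add: tendsto_iff_cs)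
  qed
  then have "\<forall>\<^sub>F x in F. norm (a x) * p (f x - l) + norm (a x - b) * p l < e"
    using e by (auto simp: cs_zero[OF p] elim: order_tendstoD)
  then show "\<forall>\<^sub>F x in F. p (s (a x) (f x) - s b l) < e"
  proof eventually_elim
    case (elim x)
    have "s (a x) (f x) - s b l = s (a x) (f x - l) + s (a x - b) l"
      by (simp add: scale_right_diff_distrib scale_left_diff_distrib)
    with elim show ?case
      using cs_triangle[OF p, of "s (a x) (f x - l)" "s (a x - b) l"] by (simp add: cs_scale[OF p])
  qed
qed

lemma tendsto_minus_cs: "(f \<longlongrightarrow> (l::'x)) F \<Longrightarrow> ((\<lambda>x. - f x) \<longlongrightarrow> - l) F"
  using tendsto_scale_cs[OF _ tendsto_const, of f l F "-1"] by simp

lemma tendsto_diff_cs: "(f \<longlongrightarrow> (l::'x)) F \<Longrightarrow> (g \<longlongrightarrow> m) F \<Longrightarrow> ((\<lambda>x. f x - g x) \<longlongrightarrow> l - m) F"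
  using tendsto_add_cs[OF _ tendsto_minus_cs, of f l F g m] by simp

lemma tendsto_sum_cs:
  "(\<And>i. i \<in> I \<Longrightarrow> (f i \<longlongrightarrow> (l i::'x)) F) \<Longrightarrow> ((\<lambda>x. \<Sum>i\<in>I. f i x) \<longlongrightarrow> (\<Sum>i\<in>I. l i)) F"
  by (induction I rule: infinite_finite_induct) (auto intro: tendsto_add_cs)

lemma continuous_on_diff_cs:
  "continuous_on S f \<Longrightarrow> continuous_on S g \<Longrightarrow> continuous_on S (\<lambda>x. f x - g x :: 'x)"
  by (auto simp: continuous_on_def intro!: tendsto_diff_cs)

lemma continuous_on_sum_cs:
  "(\<And>i. i \<in> I \<Longrightarrow> continuous_on S (f i)) \<Longrightarrow> continuous_on S (\<lambda>x. \<Sum>i\<in>I. f i x :: 'x)"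
  by (auto simp: continuous_on_def intro!: tendsto_sum_cs)

lemma continuous_on_scale_cs:
  "continuous_on S f \<Longrightarrow> continuous_on S a \<Longrightarrow> continuous_on S (\<lambda>x. s (a x) (f x))"
  by (simp add: continuous_on_def tendsto_scale_cs)

lemma continuous_on_cs: "cs p \<Longrightarrow> continuous_on S f \<Longrightarrow> continuous_on S (\<lambda>x. p (f x))"
  by (simp add: continuous_on_def tendsto_cs)

lemma seq_complete_convergent:
  assumes "seq_complete TYPE('x)"
    and "\<And>p e. cs p \<Longrightarrow> e > 0 \<Longrightarrow> \<exists>N. \<forall>m\<ge>N. \<forall>n\<ge>N. p (f m - f n) < e"
  shows "convergent f"
proof -
  have "\<exists>N. \<forall>m\<ge>N. \<forall>n\<ge>N. f m - f n \<in> V" if "open V" "0 \<in> V" for V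
  proof -
    from that obtain p e where "cs p" "e > 0" "{y. p (y - 0) < e} \<subseteq> V"
      unfolding open_iff by blast
    with assms(2)[of p e] show ?thesis
      by (auto simp: subset_iff)
  qed
  with assms(1) show ?thesis
    unfolding seq_complete_def by blast
qed

text \<open>Compactness is applied to the real function \<open>p (g x - g y)\<close> on the square,
  where \<open>(x, y)\<close> is compared with the diagonal point \<open>(x, x)\<close>; no metric
  on the target space is involved.\<close>

lemma cs_uniformly_continuous:
  fixes g :: "real \<Rightarrow> 'x"
  assumes p: "cs p" and g: "continuous_on {a..b} g" and e: "e > 0"
  obtains d where "d > 0" "\<And>x y. x \<in> {a..b} \<Longrightarrow> y \<in> {a..b} \<Longrightarrow> \<bar>x - y\<bar> < d \<Longrightarrow> p (g x - g y) < e"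
proof -
  have "continuous_on ({a..b} \<times> {a..b}) (\<lambda>z. p (g (fst z) - g (snd z)))"
    by (intro continuous_on_cs[OF p] continuous_on_diff_cs continuous_on_compose2[OF g] continuous_intros)
       auto
  then have "uniformly_continuous_on ({a..b} \<times> {a..b}) (\<lambda>z. p (g (fst z) - g (snd z)))"
    by (intro compact_uniformly_continuous compact_Times) auto
  then obtain d where d: "d > 0"
    "\<And>z w. z \<in> {a..b} \<times> {a..b} \<Longrightarrow> w \<in> {a..b} \<times> {a..b} \<Longrightarrow> dist w z < d \<Longrightarrow>
      dist (p (g (fst w) - g (snd w))) (p (g (fst z) - g (snd z))) < e"
    using e unfolding uniformly_continuous_on_def by metis
  have "p (g x - g y) < e" if "x \<in> {a..b}" "y \<in> {a..b}" "\<bar>x - y\<bar> < d" for x y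
    using that d(2)[of "(x,x)" "(x,y)"]
    by (simp add: dist_Pair_Pair dist_real_def cs_zero[OF p] abs_minus_commute)
  with d(1) show thesis using that by blast
qed

end

lemma lcs_iff: "lcs sX \<longleftrightarrow> locally_convex_space sX"
  unfolding lcs_def lcs_axioms_def locally_convex_space_def by auto

section \<open>The Riemann integral\<close>

text \<open>Distinct tagged cells meet in convex sets with empty interior, which are negligible, so
  measure is additive over the traces on \<open>K\<close>. This is what permits refining one
  division by the cells of another.\<close>

lemma content_eq_sum_tagged_division:
  fixes a b :: real
  assumes D: "D tagged_division_of {a..b}" and K: "K \<subseteq> {a..b}" "K = cbox u v"
  shows "measure lborel K = (\<Sum>z\<in>D. measure lborel (K \<inter> snd z))"
proof -
  have borel: "\<exists>u' v'. K \<inter> snd z = cbox u' v'" if z: "z \<in> D" for z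
  proof -
    obtain u' v' where "snd z = cbox u' v'"
      using tagged_division_ofD(4)[OF D, of "fst z" "snd z"] z unfolding prod.collapse by blast
    then show ?thesis
      unfolding K(2) by (intro exI[of _ "max u u'"] exI[of _ "min v v'"]) (simp add: Int_atLeastAtMost)
  qed
  have "{K. \<exists>x. (x, K) \<in> D} = snd ` D"
    by force
  then have "\<Union>(snd ` D) = {a..b}"
    using tagged_division_ofD(6)[OF D] by simp
  then have U: "(\<Union>z\<in>D. K \<inter> snd z) = K"
    using K(1) by blast
  have "measure lebesgue (\<Union>z\<in>D. K \<inter> snd z) = (\<Sum>z\<in>D. measure lebesgue (K \<inter> snd z))"
  proof (rule measure_negligible_finite_Union_image)
    show "finite D" using D by auto
    show "K \<inter> snd z \<in> lmeasurable" if "z \<in> D" for z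
      using borel[OF that] by auto
    show "pairwise (\<lambda>z w. negligible (K \<inter> snd z \<inter> (K \<inter> snd w))) D"
    proof (rule pairwiseI)
      fix z w assume zw: "z \<in> D" "w \<in> D" "z \<noteq> w"
      then have "interior (snd z) \<inter> interior (snd w) = {}"
        using tagged_division_ofD(5)[OF D, of "fst z" "snd z" "fst w" "snd w"] by simp
      then have "interior (K \<inter> snd z \<inter> (K \<inter> snd w)) = {}"
        by (simp add: interior_Int) blast
      moreover have "convex (K \<inter> snd z)" "convex (K \<inter> snd w)"
        using borel[OF zw(1)] borel[OF zw(2)] by auto
      then have "convex (K \<inter> snd z \<inter> (K \<inter> snd w))"
        by (rule convex_Int)
      ultimately show "negligible (K \<inter> snd z \<inter> (K \<inter> snd w))"
        by (simp add: negligible_convex_interior)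
    qed
  qed
  also have "\<dots> = (\<Sum>z\<in>D. measure lborel (K \<inter> snd z))"
  proof (rule sum.cong)
    fix z assume "z \<in> D"
    then obtain u' v' where "K \<inter> snd z = cbox u' v'" using borel by blast
    then show "measure lebesgue (K \<inter> snd z) = measure lborel (K \<inter> snd z)"
      by (simp add: measure_completion)
  qed simp
  finally show ?thesis
    unfolding U using K(2) by (simp add: measure_completion)
qed

lemma fine_ball_mono: "(\<lambda>x. ball x d) fine D \<Longrightarrow> d \<le> d' \<Longrightarrow> (\<lambda>x. ball x d') fine D"
  unfolding fine_def using subset_ball by blast

context lcs
begin

definition rsum :: "(real \<times> real set) set \<Rightarrow> (real \<Rightarrow> 'x) \<Rightarrow> 'x" where
  "rsum D g = (\<Sum>(x, K)\<in>D. s (of_real (measure lborel K)) (g x))"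

lemma has_riemann_integral_iff:
  "has_riemann_integral s g y a b \<longleftrightarrow>
    (\<forall>p e. cs p \<longrightarrow> e > 0 \<longrightarrow> (\<exists>\<delta>>0. \<forall>D. D tagged_division_of {a..b} \<and> (\<lambda>x. ball x \<delta>) fine D \<longrightarrow>
      p (rsum D g - y) < e))"
  (is "?L \<longleftrightarrow> ?R")
proof
  assume L: ?L
  show ?R
  proof safe
    fix p and e :: real assume p: "cs p" and e: "e > 0"
    show "\<exists>\<delta>>0. \<forall>D. D tagged_division_of {a..b} \<and> (\<lambda>x. ball x \<delta>) fine D \<longrightarrow> p (rsum D g - y) < e"
      using L[unfolded has_riemann_integral_def, rule_format, of "{z. p (z - y) < e}",
          folded rsum_def, unfolded mem_Collect_eq, OF conjI[OF open_cs_ball[OF p]]]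
      by (simp add: p e cs_zero)
  qed
next
  assume R: ?R
  show ?L
    unfolding has_riemann_integral_def
  proof safe
    fix V assume "open V" "y \<in> V"
    then obtain p e where pe: "cs p" "e > 0" and V: "{z. p (z - y) < e} \<subseteq> V"
      unfolding open_iff by blast
    obtain \<delta> where "\<delta> > 0"
      "\<forall>D. D tagged_division_of {a..b} \<and> (\<lambda>x. ball x \<delta>) fine D \<longrightarrow> p (rsum D g - y) < e"
      using R pe by blast
    with V show "\<exists>\<delta>>0. \<forall>D. D tagged_division_of {a..b} \<and> (\<lambda>x. ball x \<delta>) fine D \<longrightarrow>
        (\<Sum>(x, K)\<in>D. s (of_real (measure lborel K)) (g x)) \<in> V"
      unfolding rsum_def[symmetric] by blast
  qed
qed

lemma has_riemann_integralD:
  assumes "has_riemann_integral s g y a b" "cs p" "e > 0"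
  obtains \<delta> where "\<delta> > 0" "\<And>D. D tagged_division_of {a..b} \<Longrightarrow> (\<lambda>x. ball x \<delta>) fine D \<Longrightarrow>
      p (rsum D g - y) < e"
  using has_riemann_integral_iff[THEN iffD1, rule_format, OF assms] by blast

text \<open>The constant sequence \<open>x\<close> converges to \<open>y\<close> in every continuous
  seminorm, and the space is Hausdorff.\<close>

lemma eq_cs:
  assumes "\<And>p. cs p \<Longrightarrow> p (x - y) = 0"
  shows "x = y"
proof -
  have "((\<lambda>n::nat. x) \<longlongrightarrow> y) sequentially"
    by (intro tendstoI_cs) (simp add: assms)
  then show ?thesis
    using LIMSEQ_const_iff by blast
qed

text \<open>Both sums are rewritten over the common cells \<open>K \<inter> K'\<close>, weighted by
  their length. Pairs of disjoint cells have weight zero, so tags need comparing only where cells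
  overlap.\<close>

lemma rsum_diff_le:
  fixes a b :: real
  assumes p: "cs p" and ab: "a \<le> b"
    and D: "D tagged_division_of {a..b}" and D': "D' tagged_division_of {a..b}"
    and le: "\<And>x K x' K'. (x, K) \<in> D \<Longrightarrow> (x', K') \<in> D' \<Longrightarrow> K \<inter> K' \<noteq> {} \<Longrightarrow> p (g x - g x') \<le> e"
  shows "p (rsum D g - rsum D' g) \<le> e * (b - a)"
proof -
  define c where "c z w = measure lborel (snd z \<inter> snd w)" for z w :: "real \<times> real set"
  have c: "measure lborel (snd z) = (\<Sum>w\<in>D'. c z w)" if "z \<in> D" for z
    using content_eq_sum_tagged_division[OF D', of "snd z"]
      tagged_division_ofD(3,4)[OF D, of "fst z" "snd z"] that by (auto simp: c_def)
  have c': "measure lborel (snd w) = (\<Sum>z\<in>D. c z w)" if "w \<in> D'" for w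
    using content_eq_sum_tagged_division[OF D, of "snd w"]
      tagged_division_ofD(3,4)[OF D', of "fst w" "snd w"] that by (auto simp: c_def Int_commute)
  have 1: "rsum D g = (\<Sum>z\<in>D. \<Sum>w\<in>D'. s (of_real (c z w)) (g (fst z)))"
    unfolding rsum_def by (auto simp: case_prod_unfold c scale_sum_left intro!: sum.cong)
  have "rsum D' g = (\<Sum>w\<in>D'. \<Sum>z\<in>D. s (of_real (c z w)) (g (fst w)))"
    unfolding rsum_def by (auto simp: case_prod_unfold c' scale_sum_left intro!: sum.cong)
  also have "\<dots> = (\<Sum>z\<in>D. \<Sum>w\<in>D'. s (of_real (c z w)) (g (fst w)))"
    by (rule sum.swap)
  finally have "rsum D g - rsum D' g = (\<Sum>z\<in>D. \<Sum>w\<in>D'. s (of_real (c z w)) (g (fst z) - g (fst w)))"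
    by (simp add: 1 sum_subtractf scale_right_diff_distrib)
  then have "p (rsum D g - rsum D' g) \<le> (\<Sum>z\<in>D. p (\<Sum>w\<in>D'. s (of_real (c z w)) (g (fst z) - g (fst w))))"
    using cs_sum_le[OF p] by simp
  also have "\<dots> \<le> (\<Sum>z\<in>D. \<Sum>w\<in>D'. p (s (of_real (c z w)) (g (fst z) - g (fst w))))"
    by (intro sum_mono cs_sum_le[OF p])
  also have "\<dots> \<le> (\<Sum>z\<in>D. \<Sum>w\<in>D'. c z w * e)"
  proof (intro sum_mono)
    fix z w assume zw: "z \<in> D" "w \<in> D'"
    show "p (s (of_real (c z w)) (g (fst z) - g (fst w))) \<le> c z w * e"
    proof (cases "snd z \<inter> snd w = {}")
      case True
      then show ?thesis by (simp add: c_def cs_zero[OF p])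
    next
      case False
      then show ?thesis
        using le[of "fst z" "snd z" "fst w" "snd w"] zw
        by (simp add: cs_scale[OF p] c_def mult_left_mono)
    qed
  qed
  also have "\<dots> = (\<Sum>z\<in>D. measure lborel (snd z)) * e"
    by (simp add: c sum_distrib_right)
  also have "(\<Sum>z\<in>D. measure lborel (snd z)) = b - a"
    using additive_content_tagged_division[of D a b] D ab by (simp add: case_prod_unfold)
  finally show ?thesis by (simp add: mult.commute)
qed

lemma rsum_const_le:
  fixes a b :: real
  assumes p: "cs p" and ab: "a \<le> b" and D: "D tagged_division_of {a..b}"
    and le: "\<And>x. x \<in> {a..b} \<Longrightarrow> p (g x - z) \<le> M"
  shows "p (rsum D g - s (of_real (b - a)) z) \<le> M * (b - a)"
proof -
  have content: "(\<Sum>z\<in>D. measure lborel (snd z)) = b - a"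
    using additive_content_tagged_division[of D a b] D ab by (simp add: case_prod_unfold)
  have "s (of_real (b - a)) z = (\<Sum>w\<in>D. s (of_real (measure lborel (snd w))) z)"
    unfolding content[symmetric] by (simp add: scale_sum_left)
  then have "rsum D g - s (of_real (b - a)) z =
      (\<Sum>w\<in>D. s (of_real (measure lborel (snd w))) (g (fst w) - z))"
    by (simp add: rsum_def case_prod_unfold sum_subtractf scale_right_diff_distrib)
  then have "p (rsum D g - s (of_real (b - a)) z) \<le>
      (\<Sum>w\<in>D. p (s (of_real (measure lborel (snd w))) (g (fst w) - z)))"
    using cs_sum_le[OF p] by simp
  also have "\<dots> \<le> (\<Sum>w\<in>D. measure lborel (snd w) * M)"
  proof (rule sum_mono)
    fix w assume "w \<in> D"
    then have "fst w \<in> {a..b}"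
      using tagged_division_ofD(2,3)[OF D, of "fst w" "snd w"] by auto
    then show "p (s (of_real (measure lborel (snd w))) (g (fst w) - z)) \<le> measure lborel (snd w) * M"
      using le by (simp add: cs_scale[OF p] mult_left_mono)
  qed
  also have "\<dots> = M * (b - a)"
    by (simp add: content flip: sum_distrib_right)
  finally show ?thesis .
qed

lemma has_riemann_integral_unique:
  assumes "has_riemann_integral s g y a b" "has_riemann_integral s g z a b"
  shows "y = z"
proof (rule eq_cs)
  fix p assume p: "cs p"
  have "p (y - z) \<le> 0 + e" if "e > 0" for e
  proof -
    from that have e: "e / 2 > 0" by simp
    obtain d1 where d1: "d1 > 0" "\<And>D. D tagged_division_of {a..b} \<Longrightarrow> (\<lambda>x. ball x d1) fine D \<Longrightarrow> p (rsum D g - y) < e / 2"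
      using has_riemann_integralD[OF assms(1) p e] by blast
    obtain d2 where d2: "d2 > 0" "\<And>D. D tagged_division_of {a..b} \<Longrightarrow> (\<lambda>x. ball x d2) fine D \<Longrightarrow> p (rsum D g - z) < e / 2"
      using has_riemann_integralD[OF assms(2) p e] by blast
    have "gauge (\<lambda>x. ball x (min d1 d2))"
      using d1(1) d2(1) by (intro gauge_ball) simp
    then obtain D where D: "D tagged_division_of {a..b}" "(\<lambda>x. ball x (min d1 d2)) fine D"
      using fine_division_exists_real by blast
    have "p (rsum D g - y) < e / 2" "p (rsum D g - z) < e / 2"
      by (rule d1(2)[OF D(1) fine_ball_mono[OF D(2) min.cobounded1]]
               d2(2)[OF D(1) fine_ball_mono[OF D(2) min.cobounded2]])+
    then show ?thesis
      using cs_triangle_diff[OF p, of y z "rsum D g"] cs_diff_commute[OF p, of y "rsum D g"] by linarith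
  qed
  then have "p (y - z) \<le> 0"
    by (rule field_le_epsilon)
  with cs_nonneg[OF p] show "p (y - z) = 0"
    by (simp add: antisym)
qed

lemma riemann_integral_eq: "has_riemann_integral s g y a b \<Longrightarrow> riemann_integral s a b g = y"
  unfolding riemann_integral_def by (rule the_equality) (auto intro: has_riemann_integral_unique)

text \<open>The estimate in the seminorm \<open>p\<close> for the image under \<open>L\<close> is
  the estimate in the continuous seminorm \<open>p (L x)\<close> for \<open>g\<close>
  itself.\<close>

lemma has_riemann_integral_comp:
  assumes L: "continuous_linear s s L" and "has_riemann_integral s g y a b"
  shows "has_riemann_integral s (\<lambda>x. L (g x)) (L y) a b"
proof -
  interpret L: module_hom s s L by (rule continuous_linear_hom) fact
  have "rsum D (\<lambda>x. L (g x)) - L y = L (rsum D g - y)" for D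
    by (simp add: rsum_def L.sum L.scale L.diff case_prod_unfold)
  note 1 = this
  show ?thesis
    unfolding has_riemann_integral_iff 1
    using has_riemann_integral_iff[THEN iffD1, rule_format, OF assms(2) continuous_seminorm_comp[OF L]]
    by simp
qed

lemma has_riemann_integral_diff:
  assumes f: "has_riemann_integral s f y a b" and g: "has_riemann_integral s g z a b"
  shows "has_riemann_integral s (\<lambda>x. f x - g x) (y - z) a b"
  unfolding has_riemann_integral_iff
proof safe
  fix p and e :: real assume p: "cs p" and "e > 0"
  then have e: "e / 2 > 0" by simp
  obtain d1 where d1: "d1 > 0" "\<And>D. D tagged_division_of {a..b} \<Longrightarrow> (\<lambda>x. ball x d1) fine D \<Longrightarrow> p (rsum D f - y) < e / 2"
    using has_riemann_integralD[OF f p e] by blast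
  obtain d2 where d2: "d2 > 0" "\<And>D. D tagged_division_of {a..b} \<Longrightarrow> (\<lambda>x. ball x d2) fine D \<Longrightarrow> p (rsum D g - z) < e / 2"
    using has_riemann_integralD[OF g p e] by blast
  have "p (rsum D (\<lambda>x. f x - g x) - (y - z)) < e"
    if D: "D tagged_division_of {a..b}" "(\<lambda>x. ball x (min d1 d2)) fine D" for D
  proof -
    have "p (rsum D f - y) < e / 2" "p (rsum D g - z) < e / 2"
      by (rule d1(2)[OF D(1) fine_ball_mono[OF D(2) min.cobounded1]]
               d2(2)[OF D(1) fine_ball_mono[OF D(2) min.cobounded2]])+
    moreover have "rsum D (\<lambda>x. f x - g x) - (y - z) = (rsum D f - y) - (rsum D g - z)"
      by (simp add: rsum_def sum_subtractf case_prod_unfold scale_right_diff_distrib algebra_simps)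
    moreover have "p ((rsum D f - y) - (rsum D g - z)) \<le> p (rsum D f - y) + p (rsum D g - z)"
      by (rule cs_diff_le[OF p])
    ultimately show ?thesis
      by (simp only:)
  qed
  moreover have "min d1 d2 > 0"
    using d1(1) d2(1) by simp
  ultimately show "\<exists>\<delta>>0. \<forall>D. D tagged_division_of {a..b} \<and> (\<lambda>x. ball x \<delta>) fine D \<longrightarrow>
      p (rsum D (\<lambda>x. f x - g x) - (y - z)) < e"
    by blast
qed

lemma has_riemann_integral_cong:
  assumes "\<And>x. x \<in> {a..b} \<Longrightarrow> f x = g x" "has_riemann_integral s f y a b"
  shows "has_riemann_integral s g y a b"
proof -
  have rsum: "rsum D g = rsum D f" if D: "D tagged_division_of {a..b}" for D
    unfolding rsum_def
  proof (rule sum.cong[OF refl])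
    fix z assume "z \<in> D"
    then have "fst z \<in> {a..b}"
      using tagged_division_ofD(2,3)[OF D, of "fst z" "snd z"] by auto
    then show "(case z of (x, K) \<Rightarrow> s (of_real (measure lborel K)) (g x)) =
        (case z of (x, K) \<Rightarrow> s (of_real (measure lborel K)) (f x))"
      by (simp add: case_prod_unfold assms(1))
  qed
  show ?thesis
    unfolding has_riemann_integral_iff
  proof safe
    fix p and e :: real assume "cs p" "e > 0"
    then obtain d where d: "d > 0" "\<And>D. D tagged_division_of {a..b} \<Longrightarrow> (\<lambda>x. ball x d) fine D \<Longrightarrow> p (rsum D f - y) < e"
      using has_riemann_integralD[OF assms(2)] by blast
    have "p (rsum D g - y) < e" if "D tagged_division_of {a..b}" "(\<lambda>x. ball x d) fine D" for D
      unfolding rsum[OF that(1)] by (rule d(2)[OF that])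
    with d(1) show "\<exists>\<delta>>0. \<forall>D. D tagged_division_of {a..b} \<and> (\<lambda>x. ball x \<delta>) fine D \<longrightarrow> p (rsum D g - y) < e"
      by blast
  qed
qed

lemma riemann_integral_cong:
  assumes "\<And>x. x \<in> {a..b} \<Longrightarrow> f x = g x"
  shows "riemann_integral s a b f = riemann_integral s a b g"
  unfolding riemann_integral_def
  using has_riemann_integral_cong[of a b f g, OF assms] has_riemann_integral_cong[of a b g f, OF assms[symmetric]]
  by (intro arg_cong[where f = The] ext iffI)

text \<open>Translating tags and cells turns a fine division of one interval into a fine division of
  the other with cells of the same length.\<close>

lemma has_riemann_integral_shift:
  assumes "has_riemann_integral s g y (a + c) (b + c)"
  shows "has_riemann_integral s (\<lambda>x. g (x + c)) y a b"
  unfolding has_riemann_integral_iff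
proof safe
  fix p and e :: real assume pe: "cs p" "e > 0"
  obtain d where d: "d > 0" "\<And>D. D tagged_division_of {a + c..b + c} \<Longrightarrow> (\<lambda>x. ball x d) fine D \<Longrightarrow> p (rsum D g - y) < e"
    using has_riemann_integralD[OF assms pe] by blast
  have "p (rsum D (\<lambda>x. g (x + c)) - y) < e"
    if D: "D tagged_division_of {a..b}" "(\<lambda>x. ball x d) fine D" for D
  proof -
    define h where "h = (\<lambda>(x, K). (x + c, (+) c ` K))"
    have inj: "inj_on h D"
      by (auto simp: inj_on_def h_def inj_image_eq_iff)
    have "h ` D tagged_division_of {a + c..b + c}"
    proof (rule tagged_division_ofI)
      show "finite (h ` D)" using D(1) by auto
      fix x K assume "(x, K) \<in> h ` D"
      then obtain x' K' where xK: "(x', K') \<in> D" "x = x' + c" "K = (+) c ` K'"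
        by (auto simp: h_def)
      then show "x \<in> K" "K \<subseteq> {a + c..b + c}"
        using tagged_division_ofD(2,3)[OF D(1) xK(1)] by (auto simp: add.commute)
      obtain u v where "K' = cbox u v"
        using tagged_division_ofD(4)[OF D(1) xK(1)] by blast
      then show "\<exists>a b. K = cbox a b"
        by (auto simp: xK(3))
      fix y L assume "(y, L) \<in> h ` D" and ne: "(x, K) \<noteq> (y, L)"
      then obtain y' L' where yL: "(y', L') \<in> D" "y = y' + c" "L = (+) c ` L'"
        by (auto simp: h_def)
      then have "interior K' \<inter> interior L' = {}"
        using tagged_division_ofD(5)[OF D(1) xK(1) yL(1)] ne xK by auto
      then show "interior K \<inter> interior L = {}"
        by (auto simp: xK yL interior_translation)
    next
      have "{K. \<exists>x. (x, K) \<in> h ` D} = (`) ((+) c) ` {K. \<exists>x. (x, K) \<in> D}"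
        by (force simp: h_def)
      then have "\<Union>{K. \<exists>x. (x, K) \<in> h ` D} = (+) c ` \<Union>{K. \<exists>x. (x, K) \<in> D}"
        by (simp only: image_Union)
      then show "\<Union>{K. \<exists>x. (x, K) \<in> h ` D} = {a + c..b + c}"
        unfolding tagged_division_ofD(6)[OF D(1)] by (simp add: add.commute)
    qed
    moreover have "(\<lambda>x. ball x d) fine h ` D"
      unfolding fine_def
    proof (rule ballI)
      fix z assume "z \<in> h ` D"
      then obtain x' K' where *: "(x', K') \<in> D" "z = (x' + c, (+) c ` K')"
        by (auto simp: h_def)
      then have "K' \<subseteq> ball x' d"
        using D(2) unfolding fine_def by blast
      then show "case z of (x, K) \<Rightarrow> K \<subseteq> ball x d"
        unfolding *(2) by (auto simp: dist_real_def)
    qed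
    moreover have "rsum (h ` D) g = rsum D (\<lambda>x. g (x + c))"
    proof -
      have "measure lborel ((+) c ` K) = measure lborel K" if "(x, K) \<in> D" for x K
        using tagged_division_ofD(4)[OF D(1) that] by (auto simp: content_cbox_if)
      then show ?thesis
        unfolding rsum_def sum.reindex[OF inj] by (intro sum.cong) (auto simp: h_def)
    qed
    ultimately show ?thesis using d(2)[of "h ` D"] by simp
  qed
  then show "\<exists>\<delta>>0. \<forall>D. D tagged_division_of {a..b} \<and> (\<lambda>x. ball x \<delta>) fine D \<longrightarrow>
      p (rsum D (\<lambda>x. g (x + c)) - y) < e"
    using d(1) by blast
qed

lemma has_riemann_integral_combine:
  assumes acb: "a \<le> c" "c \<le> b"
    and y: "has_riemann_integral s g y a c" and z: "has_riemann_integral s g z c b"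
    and w: "has_riemann_integral s g w a b"
  shows "w = y + z"
proof (rule eq_cs)
  fix p assume p: "cs p"
  have "p (w - (y + z)) \<le> 0 + e" if "e > 0" for e
  proof -
    from that have e: "e / 3 > 0" by simp
    obtain d1 where d1: "d1 > 0" "\<And>D. D tagged_division_of {a..c} \<Longrightarrow> (\<lambda>x. ball x d1) fine D \<Longrightarrow> p (rsum D g - y) < e / 3"
      using has_riemann_integralD[OF y p e] by blast
    obtain d2 where d2: "d2 > 0" "\<And>D. D tagged_division_of {c..b} \<Longrightarrow> (\<lambda>x. ball x d2) fine D \<Longrightarrow> p (rsum D g - z) < e / 3"
      using has_riemann_integralD[OF z p e] by blast
    obtain d3 where d3: "d3 > 0" "\<And>D. D tagged_division_of {a..b} \<Longrightarrow> (\<lambda>x. ball x d3) fine D \<Longrightarrow> p (rsum D g - w) < e / 3"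
      using has_riemann_integralD[OF w p e] by blast
    define d where "d = min d1 (min d2 d3)"
    have d: "d > 0" "d \<le> d1" "d \<le> d2" "d \<le> d3" using d1 d2 d3 by (auto simp: d_def)
    obtain D1 where D1: "D1 tagged_division_of {a..c}" "(\<lambda>x. ball x d) fine D1"
      using fine_division_exists_real[OF gauge_ball[OF d(1)]] by blast
    obtain D2 where D2: "D2 tagged_division_of {c..b}" "(\<lambda>x. ball x d) fine D2"
      using fine_division_exists_real[OF gauge_ball[OF d(1)]] by blast
    have "{a..b} = {a..c} \<union> {c..b}" using acb by auto
    then have D: "D1 \<union> D2 tagged_division_of {a..b}"
      using tagged_division_Un[OF D1(1) D2(1)] by (simp add: interior_atLeastAtMost_real)
    have Dfine: "(\<lambda>x. ball x d) fine D1 \<union> D2"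
      using D1 D2 by (intro fine_Un)
    \<comment> \<open>A tagged cell belonging to both divisions is contained in \<open>{c}\<close>.
      Having length zero, it does no harm when the union of the two sets counts it once.\<close>
    have "measure lborel K = 0" if xK: "(x, K) \<in> D1" "(x, K) \<in> D2" for x K
    proof -
      obtain u v where K: "K = cbox u v"
        using tagged_division_ofD(4)[OF D1(1) xK(1)] by blast
      have "K \<subseteq> {c}"
        using tagged_division_ofD(3)[OF D1(1) xK(1)] tagged_division_ofD(3)[OF D2(1) xK(2)] by force
      then have "measure lborel (cbox u v) \<le> measure lborel (cbox c c)"
        unfolding K by (intro content_subset) simp
      then show ?thesis
        unfolding K using measure_nonneg[of lborel "cbox u v"] by simp
    qed
    then have 1: "rsum (D1 \<union> D2) g = rsum D1 g + rsum D2 g"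
      unfolding rsum_def using D1 D2 by (intro sum.union_inter_neutral) auto
    have "p (rsum D1 g - y) < e / 3" "p (rsum D2 g - z) < e / 3" "p (rsum (D1 \<union> D2) g - w) < e / 3"
      by (rule d1(2)[OF D1(1) fine_ball_mono[OF D1(2) d(2)]] d2(2)[OF D2(1) fine_ball_mono[OF D2(2) d(3)]]
               d3(2)[OF D fine_ball_mono[OF Dfine d(4)]])+
    moreover have "p (w - (y + z)) \<le> p ((rsum D1 g - y) + (rsum D2 g - z)) + p (rsum D1 g + rsum D2 g - w)"
      using cs_diff_le[OF p, of "(rsum D1 g - y) + (rsum D2 g - z)" "rsum D1 g + rsum D2 g - w"]
      by (simp add: algebra_simps)
    ultimately show ?thesis
      using cs_triangle[OF p, of "rsum D1 g - y" "rsum D2 g - z"] unfolding 1 by linarith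
  qed
  then have "p (w - (y + z)) \<le> 0"
    by (rule field_le_epsilon)
  with cs_nonneg[OF p] show "p (w - (y + z)) = 0"
    by (simp add: antisym)
qed

lemma has_riemann_integral_bound:
  assumes ab: "a \<le> b" and I: "has_riemann_integral s g y a b" and p: "cs p"
    and le: "\<And>x. x \<in> {a..b} \<Longrightarrow> p (g x - z) \<le> M"
  shows "p (y - s (of_real (b - a)) z) \<le> M * (b - a)"
proof (rule field_le_epsilon)
  fix e :: real assume "e > 0"
  then obtain d where d: "d > 0" "\<And>D. D tagged_division_of {a..b} \<Longrightarrow> (\<lambda>x. ball x d) fine D \<Longrightarrow> p (rsum D g - y) < e"
    using has_riemann_integralD[OF I p] by blast
  obtain D where D: "D tagged_division_of {a..b}" "(\<lambda>x. ball x d) fine D"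
    using fine_division_exists_real[OF gauge_ball[OF d(1)]] by blast
  have "p (y - s (of_real (b - a)) z) \<le> p (y - rsum D g) + p (rsum D g - s (of_real (b - a)) z)"
    by (rule cs_triangle_diff[OF p])
  with d(2)[OF D] rsum_const_le[of p a b D g z M, OF p ab D(1) le] cs_diff_commute[OF p, of y "rsum D g"]
  show "p (y - s (of_real (b - a)) z) \<le> M * (b - a) + e"
    by linarith
qed

text \<open>Completeness is only sequential, so the limit is taken along one sequence of divisions,
  fine for radius \<open>1 / Suc n\<close>. The Cauchy estimate \<open>key\<close> then carries it
  over to all sufficiently fine divisions.\<close>

lemma has_riemann_integral_exists:
  assumes complete: "seq_complete TYPE('x)" and ab: "a \<le> b" and g: "continuous_on {a..b} g"
  shows "\<exists>y. has_riemann_integral s g y a b"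
proof -
  have key: "\<exists>d>0. \<forall>D D'. D tagged_division_of {a..b} \<longrightarrow> (\<lambda>x. ball x d) fine D \<longrightarrow>
      D' tagged_division_of {a..b} \<longrightarrow> (\<lambda>x. ball x d) fine D' \<longrightarrow> p (rsum D g - rsum D' g) < e"
    if p: "cs p" and e: "e > 0" for p and e :: real
  proof -
    \<comment> \<open>The summand \<open>1\<close> covers \<open>a = b\<close> and makes the final
      estimate strict.\<close>
    have e': "e / (b - a + 1) > 0" using e ab by simp
    obtain d where d: "d > 0"
      "\<And>x y. x \<in> {a..b} \<Longrightarrow> y \<in> {a..b} \<Longrightarrow> \<bar>x - y\<bar> < d \<Longrightarrow> p (g x - g y) < e / (b - a + 1)"
      using cs_uniformly_continuous[OF p g e'] by blast
    \<comment> \<open>Overlapping cells share a point within \<open>d/2\<close> of both tags, so the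
      tags are less than \<open>d\<close> apart.\<close>
    have "p (rsum D g - rsum D' g) < e"
      if D: "D tagged_division_of {a..b}" "(\<lambda>x. ball x (d/2)) fine D"
        and D': "D' tagged_division_of {a..b}" "(\<lambda>x. ball x (d/2)) fine D'" for D D'
    proof -
      have "p (rsum D g - rsum D' g) \<le> e / (b - a + 1) * (b - a)"
      proof (rule rsum_diff_le[OF p ab D(1) D'(1)])
        fix x K x' K' assume K: "(x, K) \<in> D" "(x', K') \<in> D'" "K \<inter> K' \<noteq> {}"
        then obtain y where y: "y \<in> K" "y \<in> K'" by blast
        have "y \<in> ball x (d/2)" "y \<in> ball x' (d/2)"
          using D(2) D'(2) K y unfolding fine_def by blast+
        then have "\<bar>x - x'\<bar> < d"
          unfolding mem_ball dist_real_def by linarith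
        moreover have "x \<in> {a..b}" "x' \<in> {a..b}"
          using tagged_division_ofD(2,3)[OF D(1) K(1)] tagged_division_ofD(2,3)[OF D'(1) K(2)] by auto
        ultimately show "p (g x - g x') \<le> e / (b - a + 1)"
          using d(2) by (simp add: less_imp_le)
      qed
      also have "\<dots> < e"
        using e ab by (simp add: field_simps)
      finally show ?thesis .
    qed
    with d(1) show ?thesis
      by (intro exI[of _ "d/2"]) auto
  qed
  have "\<exists>D. D tagged_division_of {a..b} \<and> (\<lambda>x. ball x (1 / Suc n)) fine D" for n
    using fine_division_exists_real[OF gauge_ball, of "1 / Suc n" a b] by fastforce
  then obtain D where D: "\<And>n. D n tagged_division_of {a..b}" "\<And>n. (\<lambda>x. ball x (1 / Suc n)) fine D n"
    by metis
  have fine: "(\<lambda>x. ball x d) fine D n" if "n \<ge> N" "inverse (Suc N) < d" for d n N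
  proof -
    have "1 / Suc n \<le> 1 / Suc N" using that by (simp add: field_simps)
    then show ?thesis
      using that by (intro fine_ball_mono[OF D(2)]) (simp add: inverse_eq_divide)
  qed
  have "convergent (\<lambda>n. rsum (D n) g)"
  proof (rule seq_complete_convergent[OF complete])
    fix p and e :: real assume pe: "cs p" "e > 0"
    obtain d where d: "d > 0" "\<And>D D'. D tagged_division_of {a..b} \<Longrightarrow> (\<lambda>x. ball x d) fine D \<Longrightarrow>
      D' tagged_division_of {a..b} \<Longrightarrow> (\<lambda>x. ball x d) fine D' \<Longrightarrow> p (rsum D g - rsum D' g) < e"
      using key[OF pe] by blast
    obtain N where N: "inverse (Suc N) < d" using reals_Archimedean[OF d(1)] by blast
    have "p (rsum (D m) g - rsum (D n) g) < e" if "m \<ge> N" "n \<ge> N" for m n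
      by (rule d(2)[OF D(1) fine[OF that(1) N] D(1) fine[OF that(2) N]])
    then show "\<exists>N. \<forall>m\<ge>N. \<forall>n\<ge>N. p (rsum (D m) g - rsum (D n) g) < e"
      by blast
  qed
  then obtain y where y: "(\<lambda>n. rsum (D n) g) \<longlonglongrightarrow> y"
    unfolding convergent_def by blast
  have "has_riemann_integral s g y a b"
    unfolding has_riemann_integral_iff
  proof safe
    fix p and e :: real assume p: "cs p" and "e > 0"
    then have e: "e / 2 > 0" by simp
    obtain d where d: "d > 0" "\<And>D D'. D tagged_division_of {a..b} \<Longrightarrow> (\<lambda>x. ball x d) fine D \<Longrightarrow>
      D' tagged_division_of {a..b} \<Longrightarrow> (\<lambda>x. ball x d) fine D' \<Longrightarrow> p (rsum D g - rsum D' g) < e / 2"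
      using key[OF p e] by blast
    obtain N where N: "inverse (Suc N) < d" using reals_Archimedean[OF d(1)] by blast
    obtain M where M: "\<And>n. n \<ge> M \<Longrightarrow> p (rsum (D n) g - y) < e / 2"
      using tendstoD_cs[OF y p e] unfolding eventually_sequentially by blast
    have "p (rsum E g - y) < e" if E: "E tagged_division_of {a..b}" "(\<lambda>x. ball x d) fine E" for E
    proof -
      have "p (rsum E g - rsum (D (max M N)) g) < e / 2"
        by (rule d(2)[OF E D(1) fine[OF max.cobounded2 N]])
      then show ?thesis
        using cs_triangle_diff[OF p, of "rsum E g" y "rsum (D (max M N)) g"] M[of "max M N"] by simp
    qed
    then show "\<exists>\<delta>>0. \<forall>D. D tagged_division_of {a..b} \<and> (\<lambda>x. ball x \<delta>) fine D \<longrightarrow> p (rsum D g - y) < e"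
      using d(1) by blast
  qed
  then show ?thesis ..
qed

end

section \<open>Calculus of the integral of continuous functions\<close>

locale complete_lcs = lcs s
  for s :: "'k::real_normed_field \<Rightarrow> 'x::{ab_group_add,t2_space} \<Rightarrow> 'x" +
  assumes complete: "seq_complete TYPE('x)"
begin

abbreviation I where "I \<equiv> riemann_integral s"

lemma has_integral_I: "a \<le> b \<Longrightarrow> continuous_on {a..b} g \<Longrightarrow> has_riemann_integral s g (I a b g) a b"
  using has_riemann_integral_exists[OF complete, of a b g] riemann_integral_eq by metis

lemma I_comp:
  "continuous_linear s s L \<Longrightarrow> a \<le> b \<Longrightarrow> continuous_on {a..b} g \<Longrightarrow> L (I a b g) = I a b (\<lambda>x. L (g x))"
  using riemann_integral_eq[OF has_riemann_integral_comp[OF _ has_integral_I]] by simp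

lemma I_diff:
  "a \<le> b \<Longrightarrow> continuous_on {a..b} f \<Longrightarrow> continuous_on {a..b} g \<Longrightarrow>
    I a b (\<lambda>x. f x - g x) = I a b f - I a b g"
  using riemann_integral_eq[OF has_riemann_integral_diff[OF has_integral_I has_integral_I]] by simp

lemma I_shift:
  "a \<le> b \<Longrightarrow> continuous_on {a + c..b + c} g \<Longrightarrow> I a b (\<lambda>x. g (x + c)) = I (a + c) (b + c) g"
  using riemann_integral_eq[OF has_riemann_integral_shift[OF has_integral_I]] by simp

lemma I_combine:
  assumes "a \<le> c" "c \<le> b" "continuous_on {a..b} g"
  shows "I a b g = I a c g + I c b g"
proof (rule has_riemann_integral_combine[OF assms(1,2)])
  show "has_riemann_integral s g (I a c g) a c" "has_riemann_integral s g (I c b g) c b"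
    "has_riemann_integral s g (I a b g) a b"
    using assms by (auto intro!: has_integral_I intro: continuous_on_subset)
qed

lemma I_bound:
  assumes "a \<le> b" "continuous_on {a..b} g" "cs p" "\<And>x. x \<in> {a..b} \<Longrightarrow> p (g x - z) \<le> M"
  shows "p (I a b g - s (of_real (b - a)) z) \<le> M * (b - a)"
  using has_riemann_integral_bound[OF assms(1) has_integral_I[OF assms(1,2)] assms(3,4)] .

lemma I_bound0:
  assumes "a \<le> b" "continuous_on {a..b} g" "cs p" "\<And>x. x \<in> {a..b} \<Longrightarrow> p (g x) \<le> M"
  shows "p (I a b g) \<le> M * (b - a)"
  using I_bound[OF assms(1-3), of 0 M] assms(4) by simp

lemma I_refl [simp]: "I a a g = 0"
proof -
  have "continuous_on {a..a} g" by simp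
  then have "I a a g = I a a g + I a a g" by (intro I_combine) auto
  then show ?thesis by simp
qed

end

section \<open>Semigroups and their generators\<close>

text \<open>\<open>equicont\<close> ranges over all continuous seminorms and absorbs the constant
  into \<open>p\<close>, which frees the estimates from a chosen fundamental system.\<close>

locale lcs_semigroup = complete_lcs s
  for s :: "'k::real_normed_field \<Rightarrow> 'x::{ab_group_add,t2_space} \<Rightarrow> 'x" +
  fixes T :: "real \<Rightarrow> 'x \<Rightarrow> 'x"
  assumes semigroup: "operator_semigroup s T"
    and strongly_cont: "strongly_continuous T"
    and equicont: "cs q \<Longrightarrow> 0 \<le> t0 \<Longrightarrow> \<exists>p. cs p \<and> (\<forall>t x. 0 \<le> t \<longrightarrow> t \<le> t0 \<longrightarrow> q (T t x) \<le> p x)"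
begin

lemma T_linear: "0 \<le> t \<Longrightarrow> continuous_linear s s (T t)"
  and T_0 [simp]: "T 0 x = x"
  and T_add: "0 \<le> t \<Longrightarrow> 0 \<le> u \<Longrightarrow> T (t + u) x = T t (T u x)"
  using semigroup by (auto simp: operator_semigroup_def)

lemma T_module_hom: "0 \<le> t \<Longrightarrow> module_hom s s (T t)"
  by (intro continuous_linear_hom T_linear)

lemma T_diff: "0 \<le> t \<Longrightarrow> T t (x - y) = T t x - T t y"
  and T_scale: "0 \<le> t \<Longrightarrow> T t (s a x) = s a (T t x)"
  by (simp_all add: module_hom.diff[OF T_module_hom] module_hom.scale[OF T_module_hom])

lemma T_orbit_continuous: "continuous_on {0..} (\<lambda>t. T t x)"
  using strongly_cont by (simp add: strongly_continuous_def)

lemma T_commute: "0 \<le> t \<Longrightarrow> 0 \<le> u \<Longrightarrow> T t (T u x) = T u (T t x)"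
  using T_add[of t u x] T_add[of u t x] by (simp add: add.commute)

text \<open>The increment splits into \<open>T (h x) (g x - g z)\<close>, controlled by
  equicontinuity up to time \<open>t0\<close>, and an increment of the single orbit of
  \<open>g z\<close>, controlled by strong continuity.\<close>

lemma T_jointly_continuous:
  fixes g :: "'a::topological_space \<Rightarrow> 'x"
  assumes g: "continuous_on S g" and h: "continuous_on S h" and bound: "\<And>x. x \<in> S \<Longrightarrow> 0 \<le> h x \<and> h x \<le> t0"
  shows "continuous_on S (\<lambda>x. T (h x) (g x))"
  unfolding continuous_on_def
proof
  fix z assume z: "z \<in> S"
  then have t0: "0 \<le> t0" using bound[OF z] by linarith
  have "continuous_on S (\<lambda>x. T (h x) (g z))"
    using bound by (intro continuous_on_compose2[OF T_orbit_continuous h]) auto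
  then have 1: "((\<lambda>x. T (h x) (g z)) \<longlongrightarrow> T (h z) (g z)) (at z within S)"
    using z by (simp add: continuous_on_def)
  have 2: "(g \<longlongrightarrow> g z) (at z within S)"
    using z g by (simp add: continuous_on_def)
  show "((\<lambda>x. T (h x) (g x)) \<longlongrightarrow> T (h z) (g z)) (at z within S)"
  proof (rule tendstoI_cs)
    fix q and e :: real assume q: "cs q" and e: "e > 0"
    then obtain p where p: "cs p" "\<And>t x. 0 \<le> t \<Longrightarrow> t \<le> t0 \<Longrightarrow> q (T t x) \<le> p x"
      using equicont[OF q t0] by blast
    from e have e2: "e / 2 > 0" by simp
    have "\<forall>\<^sub>F x in at z within S. x \<in> S"
      by (simp add: eventually_at_filter)
    with tendstoD_cs[OF 1 q e2] tendstoD_cs[OF 2 p(1) e2]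
    show "\<forall>\<^sub>F x in at z within S. q (T (h x) (g x) - T (h z) (g z)) < e"
    proof eventually_elim
      case (elim x)
      have "q (T (h x) (g x) - T (h x) (g z)) \<le> p (g x - g z)"
        using p(2)[of "h x" "g x - g z"] bound[OF elim(3)] by (simp add: T_diff)
      with elim show ?case
        using cs_triangle_diff[OF q, of "T (h x) (g x)" "T (h z) (g z)" "T (h x) (g z)"] by linarith
    qed
  qed
qed

lemma T_reflected_continuous:
  assumes g: "continuous_on {a..b} g" and "b \<le> t"
  shows "continuous_on {a..b} (\<lambda>u. T (t - u) (g u))"
  using assms by (intro T_jointly_continuous[OF g, of _ "t - a"] continuous_intros) auto

text \<open>At a fixed step the quotient is a continuous operator and so commutes with integrals and
  limits, which \<open>gen\<close> need not do.\<close>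

lemma diff_quotient_linear: "0 \<le> e \<Longrightarrow> continuous_linear s s (\<lambda>x. diff_quotient s T x e)"
  unfolding continuous_linear_def diff_quotient_def
proof
  assume e: "0 \<le> e"
  show "Vector_Spaces.linear s s (\<lambda>x. s (of_real (1 / e)) (T e x - x))"
    using module_hom.add[OF T_module_hom[OF e]]
    by unfold_locales (simp_all add: T_scale[OF e] algebra_simps)
  show "continuous_on UNIV (\<lambda>x. s (of_real (1 / e)) (T e x - x))"
    using T_linear[OF e]
    by (intro continuous_on_scale_cs continuous_on_diff_cs continuous_on_const continuous_on_id)
       (simp add: continuous_linear_def)
qed

text \<open>The mean is taken to the left of \<open>c\<close> because the integrands met later are
  reversed orbits \<open>T (t - u) x\<close>, on which applying \<open>T e\<close> acts as a shift
  to the left. The interval \<open>{c - 1..c}\<close> merely provides room for small steps.\<close>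

lemma mean_tendsto:
  assumes g: "continuous_on {c - 1..c} g"
  shows "((\<lambda>e. s (of_real (1 / e)) (I (c - e) c g)) \<longlongrightarrow> g c) (at_right 0)"
proof (rule tendstoI_cs)
  fix p and e :: real assume p: "cs p" and e: "e > 0"
  then have "e / 2 > 0" by simp
  then obtain d where d: "d > 0"
    "\<And>x y. x \<in> {c - 1..c} \<Longrightarrow> y \<in> {c - 1..c} \<Longrightarrow> \<bar>x - y\<bar> < d \<Longrightarrow> p (g x - g y) < e / 2"
    using cs_uniformly_continuous[OF p g] by blast
  have "p (s (of_real (1 / h)) (I (c - h) c g) - g c) < e" if h: "0 < h" "h < min d 1" for h
  proof -
    have "p (I (c - h) c g - s (of_real (c - (c - h))) (g c)) \<le> e / 2 * (c - (c - h))"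
    proof (rule I_bound[OF _ _ p])
      show "continuous_on {c - h..c} g"
        using h by (intro continuous_on_subset[OF g]) auto
      show "p (g x - g c) \<le> e / 2" if "x \<in> {c - h..c}" for x
        using d(2)[of x c] h that by auto
    qed (use h in simp)
    then have "p (I (c - h) c g - s (of_real h) (g c)) / h \<le> e / 2"
      using h by (simp add: divide_simps)
    moreover have "s (of_real (1 / h)) (I (c - h) c g) - g c = s (of_real (1 / h)) (I (c - h) c g - s (of_real h) (g c))"
      using h by (simp add: scale_right_diff_distrib flip: of_real_mult)
    then have "p (s (of_real (1 / h)) (I (c - h) c g) - g c) = p (I (c - h) c g - s (of_real h) (g c)) / h"
      using h by (simp add: cs_scale[OF p] norm_divide)
    ultimately show ?thesis using e by linarith
  qed
  then show "\<forall>\<^sub>F h in at_right 0. p (s (of_real (1 / h)) (I (c - h) c g) - g c) < e"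
    using d(1) by (intro eventually_at_rightI[of 0 "min d 1"]) auto
qed

lemma T_reflected_orbit_continuous: "b \<le> t \<Longrightarrow> continuous_on {a..b} (\<lambda>u. T (t - u) x)"
  by (rule T_reflected_continuous) auto

text \<open>Applying \<open>T e\<close> moves the interval of integration to the left by
  \<open>e\<close>. The overlap cancels in the difference, and two means at the end points
  \<open>a\<close> and \<open>b\<close> remain.\<close>

lemma diff_quotient_orbit_integral:
  assumes ab: "a \<le> b" "b \<le> t"
  shows "(diff_quotient s T (I a b (\<lambda>u. T (t - u) x)) \<longlongrightarrow> T (t - a) x - T (t - b) x) (at_right 0)"
proof -
  define g where "g u = T (t - u) x" for u
  have g: "continuous_on {c..d} g" if "d \<le> t" for c d
    unfolding g_def by (rule T_reflected_orbit_continuous[OF that])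
  have eq: "diff_quotient s T (I a b g) e =
      s (of_real (1 / e)) (I (a - e) a g) - s (of_real (1 / e)) (I (b - e) b g)" if e: "0 < e" for e
  proof -
    have "T e (I a b g) = I a b (\<lambda>u. T e (g u))"
      using e ab by (intro I_comp T_linear g) auto
    also have "\<dots> = I a b (\<lambda>u. g (u + (- e)))"
    proof (rule riemann_integral_cong)
      fix u assume "u \<in> {a..b}"
      then show "T e (g u) = g (u + (- e))"
        using T_add[of e "t - u" x] e ab by (simp add: g_def algebra_simps)
    qed
    also have "\<dots> = I (a - e) (b - e) g"
      using I_shift[of a b "- e" g] e ab by (simp add: g)
    finally have 1: "T e (I a b g) = I (a - e) (b - e) g" .
    have 2: "I (a - e) b g = I (a - e) a g + I a b g" "I (a - e) b g = I (a - e) (b - e) g + I (b - e) b g"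
      using e ab by (auto intro!: I_combine g)
    have "T e (I a b g) - I a b g = I (a - e) a g - I (b - e) b g"
      unfolding 1 using 2 by (simp add: algebra_simps)
    then show ?thesis
      by (simp add: diff_quotient_def scale_right_diff_distrib)
  qed
  have "((\<lambda>e. s (of_real (1 / e)) (I (a - e) a g) - s (of_real (1 / e)) (I (b - e) b g)) \<longlongrightarrow> g a - g b) (at_right 0)"
    using ab by (intro tendsto_diff_cs mean_tendsto g) auto
  then have "(diff_quotient s T (I a b g) \<longlongrightarrow> g a - g b) (at_right 0)"
    by (rule Lim_transform_eventually) (auto intro!: eventually_at_rightI[of 0 1] simp: eq)
  then show ?thesis
    by (simp add: g_def[abs_def])
qed

text \<open>Equicontinuity on \<open>[0, t]\<close> makes the convergence of the integrands uniform.
  Applied to difference quotients it yields the integral formula for \<open>T t x - x\<close>;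
  applied to generator values it yields closedness.\<close>

lemma orbit_integral_tendsto:
  assumes t: "0 \<le> t" and f: "(f \<longlongrightarrow> v) F"
  shows "((\<lambda>n. I 0 t (\<lambda>u. T (t - u) (f n))) \<longlongrightarrow> I 0 t (\<lambda>u. T (t - u) v)) F"
proof (rule tendstoI_cs)
  fix q and e :: real assume q: "cs q" and e: "e > 0"
  obtain p where p: "cs p" "\<And>u x. 0 \<le> u \<Longrightarrow> u \<le> t \<Longrightarrow> q (T u x) \<le> p x"
    using equicont[OF q t] by blast
  have "\<forall>\<^sub>F n in F. p (f n - v) < e / (t + 1)"
    using t e by (intro tendstoD_cs[OF f p(1)]) simp
  then show "\<forall>\<^sub>F n in F. q (I 0 t (\<lambda>u. T (t - u) (f n)) - I 0 t (\<lambda>u. T (t - u) v)) < e"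
  proof eventually_elim
    case (elim n)
    have "I 0 t (\<lambda>u. T (t - u) (f n)) - I 0 t (\<lambda>u. T (t - u) v) = I 0 t (\<lambda>u. T (t - u) (f n) - T (t - u) v)"
      using t by (intro I_diff[symmetric] T_reflected_orbit_continuous) auto
    moreover have "q (I 0 t (\<lambda>u. T (t - u) (f n) - T (t - u) v)) \<le> e / (t + 1) * (t - 0)"
    proof (rule I_bound0[OF t _ q])
      show "continuous_on {0..t} (\<lambda>u. T (t - u) (f n) - T (t - u) v)"
        by (intro continuous_on_diff_cs T_reflected_orbit_continuous) auto
      show "q (T (t - u) (f n) - T (t - u) v) \<le> e / (t + 1)" if "u \<in> {0..t}" for u
        using p(2)[of "t - u" "f n - v"] that elim by (simp add: T_diff)
    qed
    moreover have "e / (t + 1) * (t - 0) < e"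
      using t e by (simp add: field_simps)
    ultimately show ?case by simp
  qed
qed

text \<open>The difference quotients of the orbit integral of \<open>x\<close> have two limits that
  must agree: one from the boundary values, the other by moving the quotient inside the
  integral.\<close>

lemma T_minus_id_eq_integral:
  assumes t: "0 \<le> t" and x: "(diff_quotient s T x \<longlongrightarrow> v) (at_right 0)"
  shows "T t x - x = I 0 t (\<lambda>u. T (t - u) v)"
proof (rule tendsto_unique)
  show "(diff_quotient s T (I 0 t (\<lambda>u. T (t - u) x)) \<longlongrightarrow> T t x - x) (at_right 0)"
    using diff_quotient_orbit_integral[of 0 t t x] t by simp
  have "I 0 t (\<lambda>u. T (t - u) (diff_quotient s T x e)) = diff_quotient s T (I 0 t (\<lambda>u. T (t - u) x)) e"
    if e: "0 < e" for e
  proof -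
    have "diff_quotient s T (I 0 t (\<lambda>u. T (t - u) x)) e = I 0 t (\<lambda>u. diff_quotient s T (T (t - u) x) e)"
      using t e by (intro I_comp[OF diff_quotient_linear] T_reflected_orbit_continuous) auto
    also have "\<dots> = I 0 t (\<lambda>u. T (t - u) (diff_quotient s T x e))"
      using e by (intro riemann_integral_cong) (simp add: diff_quotient_def T_scale T_diff T_commute[of e])
    finally show ?thesis ..
  qed
  then show "(diff_quotient s T (I 0 t (\<lambda>u. T (t - u) x)) \<longlongrightarrow> I 0 t (\<lambda>u. T (t - u) v)) (at_right 0)"
    by (intro Lim_transform_eventually[OF orbit_integral_tendsto[OF t x]])
       (auto intro!: eventually_at_rightI[of 0 1])
qed simp

text \<open>The integral formula for \<open>T t y - y\<close> involves only operators that respect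
  limits, so it passes from \<open>x n\<close> and \<open>v n\<close> to \<open>y\<close> and
  \<open>w\<close>; dividing by \<open>t\<close> and letting \<open>t\<close> tend to
  \<open>0\<close> recovers the generator.\<close>

lemma generator_closed:
  assumes x: "(x \<longlonglongrightarrow> y)" and v: "v \<longlonglongrightarrow> w"
    and gen: "\<And>n::nat. (diff_quotient s T (x n) \<longlongrightarrow> v n) (at_right 0)"
  shows "(diff_quotient s T y \<longlongrightarrow> w) (at_right 0)"
proof -
  have 1: "T t y - y = I 0 t (\<lambda>u. T (t - u) w)" if t: "0 \<le> t" for t
  proof (rule LIMSEQ_unique)
    show "(\<lambda>n. T t (x n) - x n) \<longlonglongrightarrow> T t y - y"
      by (intro tendsto_diff_cs x continuous_linear_tendsto[OF T_linear[OF t]])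
    show "(\<lambda>n. T t (x n) - x n) \<longlonglongrightarrow> I 0 t (\<lambda>u. T (t - u) w)"
      using orbit_integral_tendsto[OF t v] by (simp add: T_minus_id_eq_integral[OF t gen])
  qed
  \<comment> \<open>Moving the interval \<open>[0, t]\<close> to \<open>[-t, 0]\<close> gives an
    integrand independent of \<open>t\<close>, to which \<open>mean_tendsto\<close> applies at
    \<open>c = 0\<close>.\<close>
  define h where "h u = T (0 - u) w" for u
  have "s (of_real (1 / t)) (I (0 - t) 0 h) = diff_quotient s T y t" if t: "0 < t" for t
  proof -
    have "I 0 t (\<lambda>u. T (t - u) w) = I 0 t (\<lambda>u. h (u + (- t)))"
      by (simp add: h_def)
    also have "\<dots> = I (0 - t) 0 h"
      using I_shift[of 0 t "- t" h] t T_reflected_orbit_continuous[of 0 0 "-t" w] by (simp add: h_def)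
    finally show ?thesis
      using 1[of t] t by (simp add: diff_quotient_def)
  qed
  moreover have "((\<lambda>e. s (of_real (1 / e)) (I (0 - e) 0 h)) \<longlongrightarrow> h 0) (at_right 0)"
    unfolding h_def by (intro mean_tendsto T_reflected_orbit_continuous) simp
  ultimately have "(diff_quotient s T y \<longlongrightarrow> h 0) (at_right 0)"
    by (elim Lim_transform_eventually) (auto intro!: eventually_at_rightI[of 0 1])
  then show ?thesis by (simp add: h_def)
qed

lemma gen_eq:
  assumes "(diff_quotient s T x \<longlongrightarrow> v) (at_right 0)"
  shows "x \<in> gen_domain s T" "gen s T x = v"
  using assms by (auto simp: gen_domain_def gen_def intro!: tendsto_Lim)

lemma diff_quotient_tendsto_gen:
  "x \<in> gen_domain s T \<Longrightarrow> (diff_quotient s T x \<longlongrightarrow> gen s T x) (at_right 0)"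
  using gen_eq by (auto simp: gen_domain_def)

text \<open>Restricting to \<open>e \<le> 1\<close> makes the dominating \<open>p\<close>
  independent of \<open>e\<close>, so the bound survives \<open>e\<close> tending to
  \<open>0\<close>.\<close>

lemma diff_quotient_le_gen:
  assumes x: "x \<in> gen_domain s T" and q: "cs q" and e: "0 < e" "e \<le> 1"
    and le: "\<And>t z. 0 \<le> t \<Longrightarrow> t \<le> 1 \<Longrightarrow> q (T t z) \<le> p z"
  shows "q (diff_quotient s T x e) \<le> p (gen s T x)"
proof -
  have "T e x - x = I 0 e (\<lambda>u. T (e - u) (gen s T x))"
    using e by (intro T_minus_id_eq_integral diff_quotient_tendsto_gen x) simp
  moreover have "q (I 0 e (\<lambda>u. T (e - u) (gen s T x))) \<le> p (gen s T x) * (e - 0)"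
    using e by (intro I_bound0[OF _ _ q] T_reflected_orbit_continuous le) auto
  ultimately show ?thesis
    using e by (simp add: diff_quotient_def cs_scale[OF q] norm_divide field_simps)
qed

end

section \<open>Bounded semivariation and maximal regularity\<close>

lemma steps_mono:
  fixes \<sigma> :: "nat \<Rightarrow> real"
  assumes "\<And>i. i < n \<Longrightarrow> \<sigma> i \<le> \<sigma> (Suc i)" "i \<le> j" "j \<le> n"
  shows "\<sigma> i \<le> \<sigma> j"
  using assms(2,3)
proof (induction rule: dec_induct)
  case (step k)
  then show ?case using assms(1)[of k] by simp
qed simp

text \<open>The points \<sigma> divide elapsed time, so the intervals are collected from the right
  end \<open>t\<close> backwards.\<close>

lemma (in complete_lcs) I_split_reflected:
  assumes g: "continuous_on {0..t} g" and \<sigma>: "\<sigma> 0 = 0" "\<And>i. i < n \<Longrightarrow> \<sigma> i \<le> \<sigma> (Suc i)" "\<sigma> n = t"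
  shows "I 0 t g = (\<Sum>i<n. I (t - \<sigma> (Suc i)) (t - \<sigma> i) g)"
proof -
  have "I (t - \<sigma> k) t g = (\<Sum>i<k. I (t - \<sigma> (Suc i)) (t - \<sigma> i) g)" if "k \<le> n" for k
    using that
  proof (induction k)
    case (Suc k)
    have *: "\<sigma> 0 \<le> \<sigma> k" "\<sigma> k \<le> \<sigma> (Suc k)" "\<sigma> (Suc k) \<le> \<sigma> n"
      using Suc.prems by (auto intro!: steps_mono[of n \<sigma>, OF \<sigma>(2)])
    then have "I (t - \<sigma> (Suc k)) t g = I (t - \<sigma> (Suc k)) (t - \<sigma> k) g + I (t - \<sigma> k) t g"
      using \<sigma> by (intro I_combine continuous_on_subset[OF g]) auto
    with Suc show ?case by simp
  qed (simp add: \<sigma>)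
  from this[of n] show ?thesis using \<sigma> by simp
qed

text \<open>This is where semivariation sums come from: each interval contributes the difference of
  its orbit at the two elapsed times that bound it.\<close>

lemma (in lcs_semigroup) diff_quotient_step_tendsto:
  assumes \<sigma>: "0 \<le> \<sigma> 0" "\<And>i. i < n \<Longrightarrow> \<sigma> i \<le> \<sigma> (Suc i)"
  shows "(diff_quotient s T (\<Sum>i<n. I (t - \<sigma> (Suc i)) (t - \<sigma> i) (\<lambda>u. T (t - u) (z i)))
    \<longlongrightarrow> (\<Sum>i<n. T (\<sigma> (Suc i)) (z i) - T (\<sigma> i) (z i))) (at_right 0)"
proof -
  have "((\<lambda>e. \<Sum>i<n. diff_quotient s T (I (t - \<sigma> (Suc i)) (t - \<sigma> i) (\<lambda>u. T (t - u) (z i))) e)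
    \<longlongrightarrow> (\<Sum>i<n. T (\<sigma> (Suc i)) (z i) - T (\<sigma> i) (z i))) (at_right 0)"
  proof (rule tendsto_sum_cs)
    fix i assume "i \<in> {..<n}"
    then have "0 \<le> \<sigma> i" "\<sigma> i \<le> \<sigma> (Suc i)"
      using \<sigma>(1) steps_mono[of n \<sigma> 0 i, OF \<sigma>(2)] \<sigma>(2) by auto
    then show "(diff_quotient s T (I (t - \<sigma> (Suc i)) (t - \<sigma> i) (\<lambda>u. T (t - u) (z i)))
        \<longlongrightarrow> T (\<sigma> (Suc i)) (z i) - T (\<sigma> i) (z i)) (at_right 0)"
      using diff_quotient_orbit_integral[of "t - \<sigma> (Suc i)" "t - \<sigma> i" t "z i"] by simp
  qed
  then show ?thesis
    by (rule Lim_transform_eventually)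
       (auto intro!: eventually_at_rightI[of 0 1]
         simp: module_hom.sum[OF continuous_linear_hom[OF diff_quotient_linear]])
qed

locale lcs_convolution = lcs_semigroup s T + U: lcs sU
  for s :: "'k::real_normed_field \<Rightarrow> 'x::{ab_group_add,t2_space} \<Rightarrow> 'x"
    and T :: "real \<Rightarrow> 'x \<Rightarrow> 'x"
    and sU :: "'k \<Rightarrow> 'u::{ab_group_add,t2_space} \<Rightarrow> 'u" +
  fixes B :: "'u \<Rightarrow> 'x"
  assumes B: "continuous_linear sU s B"
begin

lemma B_diff: "B (x - y) = B x - B y"
  and B_scale: "B (sU a x) = s a (B x)"
  and B_zero [simp]: "B 0 = 0"
  using module_hom.diff[OF continuous_linear_hom[OF B]] module_hom.scale[OF continuous_linear_hom[OF B]]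
    module_hom.zero[OF continuous_linear_hom[OF B]] by auto

lemma B_continuous: "continuous_on S f \<Longrightarrow> continuous_on S (\<lambda>x. B (f x))"
  using B continuous_on_compose2[of UNIV B S f] by (auto simp: continuous_linear_def)

lemma T_zero: "0 \<le> t \<Longrightarrow> T t 0 = 0"
  using T_diff[of t 0 0] by simp

definition variation_sum :: "nat \<Rightarrow> (nat \<Rightarrow> real) \<Rightarrow> (nat \<Rightarrow> 'u) \<Rightarrow> 'x" where
  "variation_sum n \<sigma> x = (\<Sum>i<n. T (\<sigma> (Suc i)) (B (x i)) - T (\<sigma> i) (B (x i)))"

lemma variation_sum_scale:
  assumes "0 \<le> \<sigma> 0" "\<And>i. i < n \<Longrightarrow> \<sigma> i \<le> \<sigma> (Suc i)"
  shows "variation_sum n \<sigma> (\<lambda>i. sU a (x i)) = s a (variation_sum n \<sigma> x)"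
  unfolding variation_sum_def scale_sum_right
proof (rule sum.cong[OF refl])
  fix i assume "i \<in> {..<n}"
  then have "0 \<le> \<sigma> i" "\<sigma> i \<le> \<sigma> (Suc i)"
    using assms(1) steps_mono[of n \<sigma> 0 i, OF assms(2)] assms(2) by auto
  then show "T (\<sigma> (Suc i)) (B (sU a (x i))) - T (\<sigma> i) (B (sU a (x i))) =
      s a (T (\<sigma> (Suc i)) (B (x i)) - T (\<sigma> i) (B (x i)))"
    by (simp add: B_scale T_scale scale_right_diff_distrib)
qed

lemma variation_sum_diff:
  assumes "0 \<le> \<sigma> 0" "\<And>i. i < n \<Longrightarrow> \<sigma> i \<le> \<sigma> (Suc i)"
  shows "variation_sum n \<sigma> (\<lambda>i. x i - y i) = variation_sum n \<sigma> x - variation_sum n \<sigma> y"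
  unfolding variation_sum_def sum_subtractf[symmetric]
proof (rule sum.cong[OF refl])
  fix i assume "i \<in> {..<n}"
  then have "0 \<le> \<sigma> i" "\<sigma> i \<le> \<sigma> (Suc i)"
    using assms(1) steps_mono[of n \<sigma> 0 i, OF assms(2)] assms(2) by auto
  then show "T (\<sigma> (Suc i)) (B (x i - y i)) - T (\<sigma> i) (B (x i - y i)) =
      T (\<sigma> (Suc i)) (B (x i)) - T (\<sigma> i) (B (x i)) - (T (\<sigma> (Suc i)) (B (y i)) - T (\<sigma> i) (B (y i)))"
    by (simp add: B_diff T_diff)
qed

text \<open>Repeated points are allowed, and the last one may lie before \<open>r\<close>.\<close>

definition variation_bounded :: "real \<Rightarrow> bool" where
  "variation_bounded r \<longleftrightarrow> (\<forall>q. cs q \<longrightarrow> (\<exists>p M. U.cs p \<and> 0 \<le> M \<and>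
    (\<forall>n \<sigma> x. \<sigma> 0 = 0 \<longrightarrow> (\<forall>i<n. \<sigma> i \<le> \<sigma> (Suc i)) \<longrightarrow> \<sigma> n \<le> r \<longrightarrow> (\<forall>i<n. p (x i) \<le> 1) \<longrightarrow>
      q (variation_sum n \<sigma> x) \<le> M)))"

lemma variation_boundedD:
  assumes "variation_bounded r" "cs q"
  obtains p M where "U.cs p" "0 \<le> M"
    "\<And>n \<sigma> x e. \<sigma> 0 = 0 \<Longrightarrow> (\<And>i. i < n \<Longrightarrow> \<sigma> i \<le> \<sigma> (Suc i)) \<Longrightarrow> \<sigma> n \<le> r \<Longrightarrow> 0 < e \<Longrightarrow>
      (\<And>i. i < n \<Longrightarrow> p (x i) \<le> e) \<Longrightarrow> q (variation_sum n \<sigma> x) \<le> M * e"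
proof -
  obtain p M where p: "U.cs p" "0 \<le> M"
    and M: "\<And>n \<sigma> x. \<sigma> 0 = 0 \<Longrightarrow> \<forall>i<n. \<sigma> i \<le> \<sigma> (Suc i) \<Longrightarrow> \<sigma> n \<le> r \<Longrightarrow> \<forall>i<n. p (x i) \<le> 1 \<Longrightarrow>
      q (variation_sum n \<sigma> x) \<le> M"
    using assms unfolding variation_bounded_def by blast
  have "q (variation_sum n \<sigma> x) \<le> M * e"
    if *: "\<sigma> 0 = 0" "\<And>i. i < n \<Longrightarrow> \<sigma> i \<le> \<sigma> (Suc i)" "\<sigma> n \<le> r" "0 < e" "\<And>i. i < n \<Longrightarrow> p (x i) \<le> e" for n \<sigma> x e
  proof -
    have "q (variation_sum n \<sigma> (\<lambda>i. sU (of_real (1 / e)) (x i))) \<le> M"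
      using * by (intro M) (auto simp: U.cs_scale[OF p(1)] norm_divide)
    then show ?thesis
      using * by (simp add: variation_sum_scale cs_scale[OF assms(2)] norm_divide field_simps)
  qed
  with p that show thesis by blast
qed

section \<open>Step approximation on a uniform grid of elapsed time\<close>

context
  fixes r :: real and f :: "real \<Rightarrow> 'u"
  assumes r: "0 < r" and f: "continuous_on {0..r} f"
begin

text \<open>The grid \<open>j * r / n\<close> does not move with \<open>t\<close>; only the cut-off
  does. The nodes therefore depend continuously on \<open>t\<close>, and so do the generator values
  built from them.\<close>

definition node :: "nat \<Rightarrow> real \<Rightarrow> nat \<Rightarrow> real" where
  "node n t j = min (real j * r / real n) t"

text \<open>Generator value at time \<open>t\<close> for the step function that takes on each
  interval the value of \<open>f\<close> at its right end. Steps beyond the cut-off have both nodes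
  equal to \<open>t\<close> and contribute zero.\<close>

definition step_generator :: "nat \<Rightarrow> real \<Rightarrow> 'x" where
  "step_generator n t = variation_sum n (node n t) (\<lambda>j. f (t - node n t j))"

lemma node_0: "0 \<le> t \<Longrightarrow> node n t 0 = 0"
  and node_last: "0 < n \<Longrightarrow> t \<le> r \<Longrightarrow> node n t n = t"
  and node_mono: "node n t j \<le> node n t (Suc j)"
  and node_nonneg: "0 \<le> t \<Longrightarrow> 0 \<le> node n t j"
  and node_le: "node n t j \<le> t"
  and node_step: "node n t (Suc j) - node n t j \<le> r / real n"
proof -
  have "real j * r / real n \<le> real (Suc j) * r / real n"
    using r by (intro divide_right_mono mult_right_mono) auto
  then show "node n t j \<le> node n t (Suc j)"
    by (auto simp: node_def)
  have "real (Suc j) * r / real n = real j * r / real n + r / real n"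
    by (simp add: distrib_right add_divide_distrib)
  moreover have "0 \<le> r / real n" using r by simp
  moreover have "min (a + h) t - min a t \<le> h" if "0 \<le> h" for a h :: real
    using that by (auto simp: min_def)
  ultimately show "node n t (Suc j) - node n t j \<le> r / real n"
    unfolding node_def by simp
qed (use r in \<open>auto simp: node_def\<close>)

lemma node_refine: "0 < m \<Longrightarrow> node (n * m) t (i * m) = node n t i"
  by (simp add: node_def)

lemma step_generator_continuous: "continuous_on {0..r} (step_generator n)"
proof -
  have node: "continuous_on {0..r} (\<lambda>t. node n t j)" for j
    unfolding node_def by (intro continuous_intros)
  have fj: "continuous_on {0..r} (\<lambda>t. f (t - node n t j))" for j
  proof (rule continuous_on_compose2[OF f])
    show "(\<lambda>t. t - node n t j) ` {0..r} \<subseteq> {0..r}"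
      using node_nonneg[of _ n j] node_le[of n _ j] by (fastforce intro: order_trans)
  qed (intro continuous_intros node)
  show ?thesis
    unfolding step_generator_def variation_sum_def
    by (intro continuous_on_sum_cs continuous_on_diff_cs T_jointly_continuous[of _ _ _ r] B_continuous fj node)
       (use node_le[of n] in \<open>auto simp: node_nonneg intro: order_trans\<close>)
qed

text \<open>Each coarse step is cut into \<open>m\<close> fine ones that keep the coefficient of the
  coarse step, index \<open>j div m\<close>, so the new differences telescope to the old
  one.\<close>

lemma step_generator_refine:
  assumes t: "0 \<le> t" and m: "0 < m"
  shows "step_generator n t = variation_sum (n * m) (node (n * m) t) (\<lambda>j. f (t - node n t (j div m)))"
proof -
  define \<tau> where "\<tau> = node (n * m) t"
  define \<phi> where "\<phi> i u = T u (B (f (t - node n t i)))" for i u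
  have "step_generator n t = (\<Sum>i<n. \<phi> i (\<tau> (Suc i * m)) - \<phi> i (\<tau> (i * m)))"
    by (simp only: step_generator_def variation_sum_def \<phi>_def \<tau>_def node_refine[OF m])
  also have "\<dots> = (\<Sum>i<n. \<Sum>j\<in>{i * m..<i * m + m}. \<phi> i (\<tau> (Suc j)) - \<phi> i (\<tau> j))"
    by (intro sum.cong refl) (subst sum_Suc_diff', auto simp: add.commute)
  also have "\<dots> = (\<Sum>i<n. \<Sum>j\<in>{i * m..<i * m + m}. \<phi> (j div m) (\<tau> (Suc j)) - \<phi> (j div m) (\<tau> j))"
  proof (intro sum.cong refl)
    fix i j assume "j \<in> {i * m..<i * m + m}"
    then have "j div m = i"
      by (intro div_nat_eqI) (auto simp: mult.commute)
    then show "\<phi> i (\<tau> (Suc j)) - \<phi> i (\<tau> j) = \<phi> (j div m) (\<tau> (Suc j)) - \<phi> (j div m) (\<tau> j)"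
      by simp
  qed
  also have "\<dots> = (\<Sum>j<n * m. \<phi> (j div m) (\<tau> (Suc j)) - \<phi> (j div m) (\<tau> j))"
    by (rule sum.nat_group)
  finally show ?thesis
    by (simp add: variation_sum_def \<phi>_def \<tau>_def)
qed

lemma node_div_close:
  assumes n: "0 < n" and m: "0 < m"
  shows "\<bar>node n t (j div m) - node (n * m) t j\<bar> \<le> r / real n"
proof -
  define a b where "a = real (j div m)" and "b = real j / real m"
  have "j div m * m \<le> j" "j \<le> m + j div m * m"
    using dividend_less_div_times[OF m, of j] by auto
  then have "real (j div m * m) \<le> real j" "real j \<le> real (m + j div m * m)"
    using of_nat_le_iff by blast+
  then have "a \<le> b" "b \<le> a + 1"
    using m by (auto simp: a_def b_def field_simps)
  then have "a * r / real n \<le> b * r / real n" "b * r / real n \<le> (a + 1) * r / real n"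
    using r by (auto intro!: divide_right_mono mult_right_mono)
  moreover have "real j * r / real (n * m) = b * r / real n"
    by (simp add: b_def)
  moreover have "(a + 1) * r / real n = a * r / real n + r / real n"
    by (simp add: distrib_right add_divide_distrib)
  ultimately show ?thesis
    unfolding node_def a_def[symmetric] by (auto simp: min_def)
qed

text \<open>Every \<open>u\<close> lies within \<open>r / n\<close> of the sampling point of its
  interval, and \<open>f\<close> is uniformly continuous with respect to the seminorm
  \<open>p (B x)\<close>. Equicontinuity up to time \<open>r\<close> carries this through
  \<open>T (t - u)\<close>.\<close>

lemma convolution_step_tendsto:
  assumes t: "0 \<le> t" "t \<le> r"
  shows "(\<lambda>n. \<Sum>j<n. I (t - node n t (Suc j)) (t - node n t j) (\<lambda>u. T (t - u) (B (f (t - node n t j)))))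
    \<longlonglongrightarrow> convolution s T (\<lambda>u. B (f u)) t"
proof (rule tendstoI_cs)
  fix q and e :: real assume q: "cs q" and e: "e > 0"
  obtain p where p: "cs p" "\<And>u x. 0 \<le> u \<Longrightarrow> u \<le> r \<Longrightarrow> q (T u x) \<le> p x"
    using equicont[OF q, of r] r by auto
  have pB: "U.cs (\<lambda>x. p (B x))"
    by (rule continuous_seminorm_comp[OF B p(1)])
  define e' where "e' = e / (r + 1)"
  have e': "e' > 0" using e r by (simp add: e'_def)
  obtain d where d: "d > 0" "\<And>x y. x \<in> {0..r} \<Longrightarrow> y \<in> {0..r} \<Longrightarrow> \<bar>x - y\<bar> < d \<Longrightarrow> p (B (f x - f y)) < e'"
    using U.cs_uniformly_continuous[OF pB f e'] by blast
  \<comment> \<open>The case \<open>n = 0\<close> is excluded because the last node reaches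
    \<open>t\<close> only for positive \<open>n\<close>.\<close>
  have "q ((\<Sum>j<n. I (t - node n t (Suc j)) (t - node n t j) (\<lambda>u. T (t - u) (B (f (t - node n t j)))))
      - convolution s T (\<lambda>u. B (f u)) t) < e" if n: "0 < n" "r / real n < d" for n
  proof -
    define \<tau> where "\<tau> = node n t"
    have \<tau>: "0 \<le> \<tau> j" "\<tau> j \<le> \<tau> (Suc j)" "\<tau> (Suc j) \<le> t" "\<tau> (Suc j) - \<tau> j \<le> r / real n" "\<tau> 0 = 0" "\<tau> n = t" for j
      using node_nonneg[OF t(1), of n j] node_mono[of n t j] node_le[of n t "Suc j"] node_step[of n t j]
        node_0[OF t(1), of n] node_last[OF n(1) t(2)] by (auto simp: \<tau>_def)
    have cont: "continuous_on {0..t} (\<lambda>u. T (t - u) (B (f u)))"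
      using t by (intro T_reflected_continuous B_continuous continuous_on_subset[OF f]) auto
    have cont': "continuous_on {t - \<tau> (Suc j)..t - \<tau> j} (\<lambda>u. T (t - u) (B (f u)))" for j
      using \<tau>(1,3)[of j] by (intro continuous_on_subset[OF cont]) auto
    have le: "q (I (t - \<tau> (Suc j)) (t - \<tau> j) (\<lambda>u. T (t - u) (B (f (t - \<tau> j)))) -
        I (t - \<tau> (Suc j)) (t - \<tau> j) (\<lambda>u. T (t - u) (B (f u)))) \<le> e' * (\<tau> (Suc j) - \<tau> j)" for j
    proof -
      have "q (I (t - \<tau> (Suc j)) (t - \<tau> j) (\<lambda>u. T (t - u) (B (f (t - \<tau> j))) - T (t - u) (B (f u))))
          \<le> e' * (t - \<tau> j - (t - \<tau> (Suc j)))"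
      proof (rule I_bound0[OF _ _ q])
        show "continuous_on {t - \<tau> (Suc j)..t - \<tau> j} (\<lambda>u. T (t - u) (B (f (t - \<tau> j))) - T (t - u) (B (f u)))"
          using \<tau>(1)[of j] by (intro continuous_on_diff_cs cont' T_reflected_orbit_continuous) auto
        fix u assume u: "u \<in> {t - \<tau> (Suc j)..t - \<tau> j}"
        have "p (B (f (t - \<tau> j) - f u)) < e'"
          using u \<tau>(1-4)[of j] t n by (intro d(2)) auto
        moreover have "q (T (t - u) (B (f (t - \<tau> j) - f u))) \<le> p (B (f (t - \<tau> j) - f u))"
          using u \<tau>(1-4)[of j] t by (intro p(2)) auto
        moreover have "0 \<le> t - u"
          using u \<tau>(1)[of j] by simp
        ultimately show "q (T (t - u) (B (f (t - \<tau> j))) - T (t - u) (B (f u))) \<le> e'"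
          by (simp add: T_diff B_diff)
      qed (use \<tau>(2) in simp)
      moreover have "I (t - \<tau> (Suc j)) (t - \<tau> j) (\<lambda>u. T (t - u) (B (f (t - \<tau> j))) - T (t - u) (B (f u))) =
        I (t - \<tau> (Suc j)) (t - \<tau> j) (\<lambda>u. T (t - u) (B (f (t - \<tau> j)))) -
        I (t - \<tau> (Suc j)) (t - \<tau> j) (\<lambda>u. T (t - u) (B (f u)))"
        using \<tau>(1,2)[of j] by (intro I_diff cont' T_reflected_orbit_continuous) auto
      ultimately show ?thesis by simp
    qed
    have "convolution s T (\<lambda>u. B (f u)) t = (\<Sum>j<n. I (t - \<tau> (Suc j)) (t - \<tau> j) (\<lambda>u. T (t - u) (B (f u))))"
      unfolding convolution_def using \<tau> by (intro I_split_reflected cont) auto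
    then have "q ((\<Sum>j<n. I (t - \<tau> (Suc j)) (t - \<tau> j) (\<lambda>u. T (t - u) (B (f (t - \<tau> j)))))
        - convolution s T (\<lambda>u. B (f u)) t) \<le> (\<Sum>j<n. e' * (\<tau> (Suc j) - \<tau> j))"
      using order_trans[OF cs_sum_le[OF q] sum_mono[OF le]] by (simp add: sum_subtractf)
    also have "\<dots> = e' * t"
      using \<tau>(5,6) by (simp add: sum_lessThan_telescope flip: sum_distrib_left)
    also have "\<dots> \<le> e' * r"
      using e' t by simp
    also have "\<dots> < e"
      using e r by (simp add: e'_def field_simps)
    finally show ?thesis unfolding \<tau>_def .
  qed
  note close = this
  have "\<forall>\<^sub>F n in sequentially. 0 < n \<and> r / real n < d"
    by (intro eventually_conj eventually_gt_at_top order_tendstoD(2)[OF lim_const_over_n d(1)])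
  then show "\<forall>\<^sub>F n in sequentially.
      q ((\<Sum>j<n. I (t - node n t (Suc j)) (t - node n t j) (\<lambda>u. T (t - u) (B (f (t - node n t j)))))
      - convolution s T (\<lambda>u. B (f u)) t) < e"
    by (rule eventually_mono) (use close in blast)
qed

text \<open>Indices \<open>m\<close> and \<open>n\<close> are both compared with
  \<open>m * n\<close>. On that grid each difference is one variation sum whose coefficients are
  increments of \<open>f\<close> over distances at most the coarse mesh. Neither the variation bound
  nor the modulus of continuity depends on \<open>t\<close>, which gives uniformity.\<close>

lemma step_generator_Cauchy:
  assumes "variation_bounded r" and q: "cs q" and e: "e > 0"
  shows "\<exists>N>0. \<forall>m\<ge>N. \<forall>n\<ge>N. \<forall>t\<in>{0..r}. q (step_generator m t - step_generator n t) \<le> e"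
proof -
  obtain p M where p: "U.cs p" "0 \<le> M"
    "\<And>n \<sigma> x e. \<sigma> 0 = 0 \<Longrightarrow> (\<And>i. i < n \<Longrightarrow> \<sigma> i \<le> \<sigma> (Suc i)) \<Longrightarrow> \<sigma> n \<le> r \<Longrightarrow> 0 < e \<Longrightarrow>
      (\<And>i. i < n \<Longrightarrow> p (x i) \<le> e) \<Longrightarrow> q (variation_sum n \<sigma> x) \<le> M * e"
    using variation_boundedD[OF assms(1) q] by blast
  \<comment> \<open>Each of the two comparisons may cost \<open>e / 2\<close>; \<open>M + 1\<close>
    keeps the quotient meaningful when \<open>M = 0\<close>.\<close>
  define e' where "e' = e / (2 * (M + 1))"
  have e': "e' > 0" using e p(2) by (simp add: e'_def)
  obtain d where d: "d > 0" "\<And>x y. x \<in> {0..r} \<Longrightarrow> y \<in> {0..r} \<Longrightarrow> \<bar>x - y\<bar> < d \<Longrightarrow> p (f x - f y) < e'"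
    using U.cs_uniformly_continuous[OF p(1) f e'] by blast
  obtain N :: nat where N: "r / d < real N" using reals_Archimedean2 by blast
  then have "0 < real N" using r d(1) by (intro less_trans[OF _ N]) simp
  then have N0: "0 < N" by simp
  have refine: "q (step_generator n t - step_generator (n * m) t) \<le> e / 2"
    if nm: "n \<ge> N" "m \<ge> N" and t: "t \<in> {0..r}" for n m t
  proof -
    have n: "0 < n" and m: "0 < m" using nm N0 by auto
    have "r / d < real n" using N nm(1) by linarith
    then have rn: "r / real n < d" using n d(1) by (simp add: field_simps)
    have node: "node (n * m) t 0 = 0" "\<And>i. node (n * m) t i \<le> node (n * m) t (Suc i)" "node (n * m) t (n * m) \<le> r"
      using t node_0 node_mono node_le[of "n * m" t "n * m"] by auto
    have "step_generator n t - step_generator (n * m) t =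
        variation_sum (n * m) (node (n * m) t) (\<lambda>j. f (t - node n t (j div m)) - f (t - node (n * m) t j))"
      using step_generator_refine[of t m n] t m node by (simp add: variation_sum_diff step_generator_def[of "n * m"])
    moreover have "q (variation_sum (n * m) (node (n * m) t) (\<lambda>j. f (t - node n t (j div m)) - f (t - node (n * m) t j)))
        \<le> M * e'"
    proof (rule p(3)[OF node(1,2,3) e'])
      fix j
      show "p (f (t - node n t (j div m)) - f (t - node (n * m) t j)) \<le> e'"
      proof (intro less_imp_le d(2))
        show "t - node n t (j div m) \<in> {0..r}" "t - node (n * m) t j \<in> {0..r}"
          using t node_le[of n t] node_nonneg[of t n] node_le[of "n * m" t] node_nonneg[of t "n * m"]
          by (simp_all add: add_increasing2 diff_le_eq)
        show "\<bar>t - node n t (j div m) - (t - node (n * m) t j)\<bar> < d"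
          using node_div_close[OF n m, of t j] rn by linarith
      qed
    qed
    moreover have "M * e' \<le> e / 2"
      using p(2) e by (simp add: e'_def field_simps)
    ultimately show ?thesis by simp
  qed
  have "q (step_generator m t - step_generator n t) \<le> e" if "m \<ge> N" "n \<ge> N" "t \<in> {0..r}" for m n t
    using refine[of m n t] refine[of n m t] that
      cs_triangle_diff[OF q, of "step_generator m t" "step_generator n t" "step_generator (m * n) t"]
      cs_diff_commute[OF q, of "step_generator n t"]
    by (simp add: mult.commute)
  with N0 show ?thesis by blast
qed

lemma convolution_generator:
  assumes "variation_bounded r"
  obtains G where "continuous_on {0..r} G"
    "\<And>t. t \<in> {0..r} \<Longrightarrow> (diff_quotient s T (convolution s T (\<lambda>u. B (f u)) t) \<longlongrightarrow> G t) (at_right 0)"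
proof -
  have "convergent (\<lambda>n. step_generator n t)" if t: "t \<in> {0..r}" for t
  proof (rule seq_complete_convergent[OF complete])
    fix p and e :: real assume p: "cs p" and "e > 0"
    then have "e / 2 > 0" by simp
    then obtain N where "\<forall>m\<ge>N. \<forall>n\<ge>N. \<forall>t\<in>{0..r}. p (step_generator m t - step_generator n t) \<le> e / 2"
      using step_generator_Cauchy[OF assms p] by blast
    with t \<open>e > 0\<close> show "\<exists>N. \<forall>m\<ge>N. \<forall>n\<ge>N. p (step_generator m t - step_generator n t) < e"
      by (intro exI[of _ N]) force
  qed
  then obtain G where G: "\<And>t. t \<in> {0..r} \<Longrightarrow> (\<lambda>n. step_generator n t) \<longlonglongrightarrow> G t"
    unfolding convergent_def by metis
  have unif: "\<exists>n. \<forall>t\<in>{0..r}. q (step_generator n t - G t) \<le> e" if q: "cs q" and e: "e > 0" for q e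
  proof -
    obtain N where N: "\<And>m n t. m \<ge> N \<Longrightarrow> n \<ge> N \<Longrightarrow> t \<in> {0..r} \<Longrightarrow> q (step_generator m t - step_generator n t) \<le> e"
      using step_generator_Cauchy[OF assms q e] by blast
    \<comment> \<open>Since \<open>N\<close> is independent of \<open>t\<close>, letting
      \<open>n\<close> tend to infinity in the Cauchy estimate turns pointwise into uniform
      convergence.\<close>
    have "q (step_generator N t - G t) \<le> e" if t: "t \<in> {0..r}" for t
    proof (rule tendsto_upperbound)
      show "(\<lambda>n. q (step_generator N t - step_generator n t)) \<longlonglongrightarrow> q (step_generator N t - G t)"
        by (intro tendsto_cs[OF q] tendsto_diff_cs tendsto_const G t)
      show "\<forall>\<^sub>F n in sequentially. q (step_generator N t - step_generator n t) \<le> e"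
        using N t unfolding eventually_sequentially by blast
    qed simp
    then show ?thesis by blast
  qed
  have "continuous_on {0..r} G"
    unfolding continuous_on_def
  proof
    fix t assume t: "t \<in> {0..r}"
    show "(G \<longlongrightarrow> G t) (at t within {0..r})"
    proof (rule tendstoI_cs)
      fix q and e :: real assume q: "cs q" and e: "e > 0"
      then have e3: "e / 3 > 0" by simp
      obtain n where n: "\<And>t. t \<in> {0..r} \<Longrightarrow> q (step_generator n t - G t) \<le> e / 3"
        using unif[OF q e3] by blast
      have "(step_generator n \<longlongrightarrow> step_generator n t) (at t within {0..r})"
        using step_generator_continuous t by (simp add: continuous_on_def)
      from tendstoD_cs[OF this q e3] have "\<forall>\<^sub>F u in at t within {0..r}. q (step_generator n u - step_generator n t) < e / 3" .
      moreover have "\<forall>\<^sub>F u in at t within {0..r}. u \<in> {0..r}"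
        by (simp add: eventually_at_filter)
      ultimately show "\<forall>\<^sub>F u in at t within {0..r}. q (G u - G t) < e"
      proof eventually_elim
        case (elim u)
        have "q (G u - G t) \<le> q (G u - step_generator n u) + q (step_generator n u - step_generator n t) + q (step_generator n t - G t)"
          using cs_triangle_diff[OF q, of "G u" "G t" "step_generator n u"]
            cs_triangle_diff[OF q, of "step_generator n u" "G t" "step_generator n t"] by linarith
        with elim n[OF elim(2)] n[OF t] cs_diff_commute[OF q, of "G u" "step_generator n u"]
        show ?case by linarith
      qed
    qed
  qed
  \<comment> \<open>Closedness is applied at a fixed \<open>t\<close>: the convolutions of the
    sampled step functions converge to that of \<open>f\<close>, and their generator values to
    \<open>G t\<close>.\<close>
  moreover have "(diff_quotient s T (convolution s T (\<lambda>u. B (f u)) t) \<longlongrightarrow> G t) (at_right 0)" if t: "t \<in> {0..r}" for t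
  proof (rule generator_closed[OF convolution_step_tendsto G[OF t]])
    show "(diff_quotient s T (\<Sum>j<n. I (t - node n t (Suc j)) (t - node n t j) (\<lambda>u. T (t - u) (B (f (t - node n t j)))))
        \<longlongrightarrow> step_generator n t) (at_right 0)" for n
      unfolding step_generator_def variation_sum_def
      using t by (intro diff_quotient_step_tendsto node_mono node_nonneg) simp
  qed (use t in auto)
  ultimately show thesis using that by blast
qed

end

lemma C_maximal_regularityI:
  assumes r: "0 < r" and "variation_bounded r"
  shows "C_maximal_regularity s T B r"
  unfolding C_maximal_regularity_def
proof
  fix f :: "real \<Rightarrow> 'u" assume "f \<in> C_space r"
  then have "continuous_on {0..r} f" by (simp add: C_space_def)
  from convolution_generator[OF r this assms(2)] obtain G where G: "continuous_on {0..r} G"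
    and lim: "\<And>t. t \<in> {0..r} \<Longrightarrow> (diff_quotient s T (convolution s T (\<lambda>u. B (f u)) t) \<longlongrightarrow> G t) (at_right 0)"
    by blast
  have "continuous_on {0..r} (\<lambda>t. gen s T (convolution s T (\<lambda>u. B (f u)) t))"
    using G by (rule continuous_on_eq) (simp add: gen_eq(2)[OF lim])
  with gen_eq(1)[OF lim] show "(\<forall>t\<in>{0..r}. convolution s T (\<lambda>u. B (f u)) t \<in> gen_domain s T) \<and>
      continuous_on {0..r} (\<lambda>t. gen s T (convolution s T (\<lambda>u. B (f u)) t))"
    by blast
qed

end

section \<open>3C-spaces and bounded semivariation\<close>

text \<open>The ramps lie inside \<open>[u, v]\<close> and the function vanishes at both ends, so
  bumps on adjacent intervals never overlap. If \<open>2 * h > v - u\<close> the plateau disappears,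
  but the values stay in \<open>[0, 1]\<close>.\<close>

definition trapezoid :: "real \<Rightarrow> real \<Rightarrow> real \<Rightarrow> real \<Rightarrow> real" where
  "trapezoid u v h w = max 0 (min 1 (min (w - u) (v - w) / h))"

lemma trapezoid_range: "0 \<le> trapezoid u v h w" "trapezoid u v h w \<le> 1"
  by (auto simp: trapezoid_def)

lemma trapezoid_eq_0: "0 < h \<Longrightarrow> w \<le> u \<or> v \<le> w \<Longrightarrow> trapezoid u v h w = 0"
  by (auto simp: trapezoid_def min_def max_def divide_simps)

lemma trapezoid_eq_1: "0 < h \<Longrightarrow> u + h \<le> w \<Longrightarrow> w \<le> v - h \<Longrightarrow> trapezoid u v h w = 1"
  by (auto simp: trapezoid_def min_def max_def divide_simps)

lemma trapezoid_continuous: "0 < h \<Longrightarrow> continuous_on S (trapezoid u v h)"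
  unfolding trapezoid_def by (intro continuous_intros) auto

text \<open>The weight differs from \<open>1\<close> only on two strips of width \<open>h\<close>,
  where the integrand changes by at most \<open>M\<close>; the total error is at most
  \<open>2 * M * h\<close>.\<close>

lemma (in complete_lcs) trapezoid_integral_tendsto:
  assumes uv: "u < v" and g: "continuous_on {u..v} g"
  shows "((\<lambda>h. I u v (\<lambda>w. s (of_real (trapezoid u v h w)) (g w))) \<longlongrightarrow> I u v g) (at_right 0)"
proof (rule tendstoI_cs)
  fix p and e :: real assume p: "cs p" and e: "e > 0"
  have "bounded ((\<lambda>w. p (g w)) ` {u..v})"
    by (intro compact_imp_bounded compact_continuous_image continuous_on_cs[OF p] g) simp
  then obtain M where M: "M > 0" "\<And>w. w \<in> {u..v} \<Longrightarrow> norm (p (g w)) \<le> M"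
    unfolding bounded_pos by blast
  have "p (I u v (\<lambda>w. s (of_real (trapezoid u v h w)) (g w)) - I u v g) < e"
    if h: "0 < h" "h < min ((v - u) / 2) (e / (2 * M))" for h
  proof -
    define k where "k w = s (of_real (trapezoid u v h w)) (g w) - g w" for w
    have k: "continuous_on {a..b} k" if "u \<le> a" "b \<le> v" for a b
      unfolding k_def using h(1) that
      by (intro continuous_on_diff_cs continuous_on_scale_cs continuous_on_subset[OF g]
          continuous_on_of_real trapezoid_continuous) auto
    have k_eq: "k w = s (of_real (trapezoid u v h w - 1)) (g w)" for w
      by (simp add: k_def scale_left_diff_distrib)
    have kM: "p (k w) \<le> M" if "w \<in> {u..v}" for w
    proof -
      have "\<bar>trapezoid u v h w - 1\<bar> * p (g w) \<le> 1 * M"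
        using M(2)[OF that] M(1) trapezoid_range[of u v h w] cs_nonneg[OF p]
        by (intro mult_mono) auto
      then show ?thesis
        unfolding k_eq cs_scale[OF p] norm_of_real by simp
    qed
    have h2: "u \<le> u + h" "u + h \<le> v - h" "v - h \<le> v" using h by auto
    have "I u v k = I u (u + h) k + I (u + h) v k" "I (u + h) v k = I (u + h) (v - h) k + I (v - h) v k"
      using h2 by (auto intro!: I_combine k)
    moreover have "I (u + h) (v - h) k = I (u + h) (v - h) (\<lambda>w. 0)"
      using h(1) by (intro riemann_integral_cong) (simp add: k_eq trapezoid_eq_1)
    moreover have "I (u + h) (v - h) (\<lambda>w. 0) = 0"
      using I_diff[OF h2(2) k k] h2 by simp
    moreover have "p (I u (u + h) k) \<le> M * (u + h - u)" "p (I (v - h) v k) \<le> M * (v - (v - h))"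
      using h(1) h2 by (intro I_bound0[OF _ _ p] k kM; simp)+
    ultimately have "p (I u v k) \<le> 2 * M * h"
      using cs_triangle[OF p, of "I u (u + h) k" "I (v - h) v k"] by simp
    also have "\<dots> < e"
      using h M(1) by (simp add: field_simps)
    finally have "p (I u v k) < e" .
    moreover have "I u v k = I u v (\<lambda>w. s (of_real (trapezoid u v h w)) (g w)) - I u v g"
      unfolding k_def using uv h(1)
      by (intro I_diff continuous_on_scale_cs g continuous_on_of_real trapezoid_continuous) auto
    ultimately show ?thesis by simp
  qed
  then show "\<forall>\<^sub>F h in at_right 0. p (I u v (\<lambda>w. s (of_real (trapezoid u v h w)) (g w)) - I u v g) < e"
    using uv e M(1) by (intro eventually_at_rightI[of 0 "min ((v - u) / 2) (e / (2 * M))"]) auto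
qed

text \<open>\<open>C_topology\<close> is given by a subbasis of balls around arbitrary centres.
  Induction over the generation of open sets recentres them at \<open>f\<close>, and the pointwise
  form of the neighbourhood replaces the supremum.\<close>

lemma (in lcs) C_topology_nbhd:
  assumes \<Gamma>: "\<And>p. p \<in> \<Gamma> \<Longrightarrow> cs p"
    and "openin (C_topology r \<Gamma>) W" "f \<in> W"
  shows "\<exists>p \<delta>. cs p \<and> \<delta> > 0 \<and> {g \<in> C_space r. \<forall>w\<in>{0..r}. p (g w - f w) < \<delta>} \<subseteq> W"
proof (cases "r < 0")
  case True
  \<comment> \<open>For negative \<open>r\<close> the interval is empty and \<open>C_space r\<close>
    has a single element, so any seminorm serves.\<close>
  have "cs (\<lambda>x. 0)"
    by (simp add: continuous_seminorm_def seminorm_def)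
  have "C_space r = {\<lambda>x. undefined :: 'x}"
    using True by (auto simp: C_space_def)
  moreover have "W \<subseteq> C_space r"
    using openin_subset[OF assms(2)] by (auto simp: C_topology_def)
  ultimately have "C_space r \<subseteq> W"
    using assms(3) by auto
  with \<open>cs (\<lambda>x. 0)\<close> show ?thesis
    by (intro exI[of _ "\<lambda>x. 0"] exI[of _ 1]) auto
next
  case False
  have bdd: "bdd_above ((\<lambda>w. p (g w - f w)) ` {0..r})" if "cs p" "g \<in> C_space r" "f \<in> C_space r" for p f g
  proof (rule bounded_imp_bdd_above, rule compact_imp_bounded, rule compact_continuous_image)
    show "continuous_on {0..r} (\<lambda>w. p (g w - f w))"
      using that by (intro continuous_on_cs continuous_on_diff_cs) (auto simp: C_space_def)
  qed simp
  have "generate_topology_on {{g \<in> C_space r. sup_seminorm r p (\<lambda>w. g w - f w) < e} | f p e.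
      f \<in> C_space r \<and> p \<in> \<Gamma> \<and> e > 0} W"
    using assms(2) unfolding C_topology_def by (simp add: openin_topology_generated_by_iff)
  then show ?thesis
    using assms(3)
  proof (induction arbitrary: f rule: generate_topology_on.induct)
    case (Int V W)
    then obtain p1 d1 p2 d2 where *: "cs p1" "d1 > 0" "{g \<in> C_space r. \<forall>w\<in>{0..r}. p1 (g w - f w) < d1} \<subseteq> V"
      "cs p2" "d2 > 0" "{g \<in> C_space r. \<forall>w\<in>{0..r}. p2 (g w - f w) < d2} \<subseteq> W"
      using Int.IH(1)[of f] Int.IH(2)[of f] Int.prems by blast
    \<comment> \<open>The sum \<open>p1 + p2\<close> is again a continuous seminorm and dominates
      both.\<close>
    have "g \<in> V \<inter> W" if g: "g \<in> C_space r" "\<forall>w\<in>{0..r}. p1 (g w - f w) + p2 (g w - f w) < min d1 d2" for g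
    proof -
      have "p1 (g w - f w) < d1 \<and> p2 (g w - f w) < d2" if "w \<in> {0..r}" for w
        using bspec[OF g(2) that] cs_nonneg[OF *(1), of "g w - f w"] cs_nonneg[OF *(4), of "g w - f w"]
        by linarith
      with g(1) *(3,6) show ?thesis by blast
    qed
    with * cs_add[OF *(1,4)] show ?case
      by (intro exI[of _ "\<lambda>x. p1 x + p2 x"] exI[of _ "min d1 d2"]) auto
  next
    case (UN K)
    then obtain k where "k \<in> K" "f \<in> k" by blast
    with UN.IH[OF this] show ?case by blast
  next
    case (Basis V)
    then obtain f0 p e where V: "V = {g \<in> C_space r. sup_seminorm r p (\<lambda>w. g w - f0 w) < e}"
      and f0: "f0 \<in> C_space r" and p: "cs p"
      using \<Gamma> by blast
    \<comment> \<open>Half of the remaining radius: a strict pointwise bound yields only a weak one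
      for the supremum.\<close>
    define d where "d = (e - sup_seminorm r p (\<lambda>w. f w - f0 w)) / 2"
    have f: "f \<in> C_space r" and d: "d > 0"
      using Basis.prems by (auto simp: V d_def)
    have "g \<in> V" if g: "g \<in> C_space r" "\<forall>w\<in>{0..r}. p (g w - f w) < d" for g
    proof -
      have "sup_seminorm r p (\<lambda>w. g w - f0 w) \<le> sup_seminorm r p (\<lambda>w. f w - f0 w) + d"
        unfolding sup_seminorm_def
      proof (rule cSUP_least)
        fix w assume w: "w \<in> {0..r}"
        have "p (f w - f0 w) \<le> (SUP w\<in>{0..r}. p (f w - f0 w))"
          by (rule cSUP_upper[OF w bdd[OF p f f0]])
        with bspec[OF g(2) w] cs_triangle_diff[OF p, of "g w" "f0 w" "f w"]
        show "p (g w - f0 w) \<le> (SUP w\<in>{0..r}. p (f w - f0 w)) + d"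
          by linarith
      qed (use False in simp)
      then have "sup_seminorm r p (\<lambda>w. g w - f0 w) < e"
        using d by (simp add: d_def field_simps)
      with g(1) show ?thesis by (simp add: V)
    qed
    with p d show ?case by blast
  qed simp
qed

lemma strict_partition:
  fixes \<sigma> :: "nat \<Rightarrow> real" and \<alpha> :: "real \<Rightarrow> 'u \<Rightarrow> 'x::ab_group_add"
  assumes "\<And>i. i < n \<Longrightarrow> \<sigma> i \<le> \<sigma> (Suc i)" "\<And>i. i < n \<Longrightarrow> P (x i)"
  shows "\<exists>m d y. d 0 = \<sigma> 0 \<and> d m = \<sigma> n \<and> (\<forall>i<m. d i < d (Suc i)) \<and> (\<forall>i<m. P (y i)) \<and>
    (\<Sum>i<m. \<alpha> (d (Suc i)) (y i) - \<alpha> (d i) (y i)) = (\<Sum>i<n. \<alpha> (\<sigma> (Suc i)) (x i) - \<alpha> (\<sigma> i) (x i))"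
  using assms
proof (induction n)
  case 0
  show ?case by (intro exI[of _ 0] exI[of _ \<sigma>]) simp
next
  case (Suc n)
  have "\<exists>m d y. d 0 = \<sigma> 0 \<and> d m = \<sigma> n \<and> (\<forall>i<m. d i < d (Suc i)) \<and> (\<forall>i<m. P (y i)) \<and>
    (\<Sum>i<m. \<alpha> (d (Suc i)) (y i) - \<alpha> (d i) (y i)) = (\<Sum>i<n. \<alpha> (\<sigma> (Suc i)) (x i) - \<alpha> (\<sigma> i) (x i))"
    by (rule Suc.IH) (simp_all add: Suc.prems)
  then obtain m d y where IH: "d 0 = \<sigma> 0" "d m = \<sigma> n" "\<And>i. i < m \<Longrightarrow> d i < d (Suc i)" "\<And>i. i < m \<Longrightarrow> P (y i)"
    "(\<Sum>i<m. \<alpha> (d (Suc i)) (y i) - \<alpha> (d i) (y i)) = (\<Sum>i<n. \<alpha> (\<sigma> (Suc i)) (x i) - \<alpha> (\<sigma> i) (x i))"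
    by blast
  show ?case
  proof (cases "\<sigma> n = \<sigma> (Suc n)")
    case True
    with IH show ?thesis
      by (intro exI[of _ m] exI[of _ d] exI[of _ y]) simp
  next
    case False
    then have lt: "d m < \<sigma> (Suc n)"
      using Suc.prems(1)[of n] IH(2) by simp
    define d' where "d' = d(Suc m := \<sigma> (Suc n))"
    define y' where "y' = y(m := x n)"
    have "(\<Sum>i<m. \<alpha> (d' (Suc i)) (y' i) - \<alpha> (d' i) (y' i)) = (\<Sum>i<m. \<alpha> (d (Suc i)) (y i) - \<alpha> (d i) (y i))"
      by (intro sum.cong) (auto simp: d'_def y'_def)
    then have "(\<Sum>i<Suc m. \<alpha> (d' (Suc i)) (y' i) - \<alpha> (d' i) (y' i)) =
        (\<Sum>i<Suc n. \<alpha> (\<sigma> (Suc i)) (x i) - \<alpha> (\<sigma> i) (x i))"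
      using IH by (simp add: d'_def y'_def)
    moreover have "d' 0 = \<sigma> 0" "d' (Suc m) = \<sigma> (Suc n)"
      using IH by (auto simp: d'_def)
    moreover have "\<forall>i<Suc m. d' i < d' (Suc i)" "\<forall>i<Suc m. P (y' i)"
      using IH(3,4) lt Suc.prems(2)[of n] by (auto simp: d'_def y'_def less_Suc_eq)
    ultimately show ?thesis
      by (intro exI[of _ "Suc m"] exI[of _ d'] exI[of _ y'] conjI)
  qed
qed

context lcs_convolution
begin

text \<open>A partition that stops before \<open>r\<close> is extended by one step up to
  \<open>r\<close> with coefficient \<open>0\<close>, then made strict; neither repair changes the
  sum.\<close>

lemma bounded_semivariation_imp_variation_bounded:
  assumes \<Gamma>X: "fundamental_system s \<Gamma>X" and \<Gamma>U: "fundamental_system sU \<Gamma>U"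
    and bsv: "bounded_semivariation \<Gamma>X \<Gamma>U (\<lambda>t x. T t (B x)) 0 r"
  shows "variation_bounded r"
  unfolding variation_bounded_def
proof safe
  fix q assume "cs q"
  then obtain q0 C where q0: "q0 \<in> \<Gamma>X" "C \<ge> 0" "\<And>x. q x \<le> C * q0 x"
    using \<Gamma>X unfolding fundamental_system_def by blast
  obtain p where p: "p \<in> \<Gamma>U" and fin: "semivariation q0 p (\<lambda>t x. T t (B x)) 0 r < \<infinity>"
    using bsv q0(1) unfolding bounded_semivariation_def by blast
  have pcs: "U.cs p" using p \<Gamma>U by (simp add: fundamental_system_def)
  define M where "M = max 0 (real_of_ereal (semivariation q0 p (\<lambda>t x. T t (B x)) 0 r))"
  have M: "q0 (variation_sum n d x) \<le> M"
    if "d 0 = 0" "d n = r" "\<forall>i<n. d i < d (Suc i)" "\<forall>i<n. p (x i) \<le> 1" for n d x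
  proof -
    have "ereal (q0 (variation_sum n d x)) \<le> semivariation q0 p (\<lambda>t x. T t (B x)) 0 r"
      unfolding semivariation_def variation_sum_def using that by (intro Sup_upper) blast
    then show ?thesis
      using fin unfolding M_def
      by (cases "semivariation q0 p (\<lambda>t x. T t (B x)) 0 r") auto
  qed
  have "q (variation_sum n \<sigma> x) \<le> C * M"
    if \<sigma>: "\<sigma> 0 = 0" "\<forall>i<n. \<sigma> i \<le> \<sigma> (Suc i)" "\<sigma> n \<le> r" and x: "\<forall>i<n. p (x i) \<le> 1" for n \<sigma> x
  proof -
    have "0 \<le> \<sigma> n"
      using steps_mono[of n \<sigma> 0 n] \<sigma> by simp
    define \<sigma>' where "\<sigma>' = \<sigma>(Suc n := r)"
    define x' where "x' = x(n := 0)"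
    have "(\<Sum>i<n. T (\<sigma>' (Suc i)) (B (x' i)) - T (\<sigma>' i) (B (x' i))) = variation_sum n \<sigma> x"
      unfolding variation_sum_def by (intro sum.cong) (auto simp: \<sigma>'_def x'_def)
    then have eq: "(\<Sum>i<Suc n. T (\<sigma>' (Suc i)) (B (x' i)) - T (\<sigma>' i) (B (x' i))) = variation_sum n \<sigma> x"
      using \<open>0 \<le> \<sigma> n\<close> \<sigma>(3) by (simp add: \<sigma>'_def x'_def T_zero)
    have "\<sigma>' i \<le> \<sigma>' (Suc i)" "p (x' i) \<le> 1" if "i < Suc n" for i
      using that \<sigma> x by (auto simp: \<sigma>'_def x'_def less_Suc_eq U.cs_zero[OF pcs])
    from strict_partition[of "Suc n" \<sigma>' "\<lambda>x. p x \<le> 1" x' "\<lambda>t x. T t (B x)", OF this]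
    obtain m d y where d: "d 0 = \<sigma>' 0" "d m = \<sigma>' (Suc n)" "\<forall>i<m. d i < d (Suc i)" "\<forall>i<m. p (y i) \<le> 1"
      and sum: "(\<Sum>i<m. T (d (Suc i)) (B (y i)) - T (d i) (B (y i))) =
        (\<Sum>i<Suc n. T (\<sigma>' (Suc i)) (B (x' i)) - T (\<sigma>' i) (B (x' i)))"
      by blast
    have "q0 (variation_sum m d y) \<le> M"
      using d \<sigma>(1) by (intro M) (simp_all add: \<sigma>'_def)
    then have "q0 (variation_sum n \<sigma> x) \<le> M"
      using sum unfolding eq by (simp add: variation_sum_def)
    then show ?thesis
      using q0(2) q0(3)[of "variation_sum n \<sigma> x"] mult_left_mono[of "q0 (variation_sum n \<sigma> x)" M C] by linarith
  qed
  with pcs q0(2) show "\<exists>p M. U.cs p \<and> 0 \<le> M \<and>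
    (\<forall>n \<sigma> x. \<sigma> 0 = 0 \<longrightarrow> (\<forall>i<n. \<sigma> i \<le> \<sigma> (Suc i)) \<longrightarrow> \<sigma> n \<le> r \<longrightarrow> (\<forall>i<n. p (x i) \<le> 1) \<longrightarrow>
      q (variation_sum n \<sigma> x) \<le> M)"
    by (intro exI[of _ p] exI[of _ "C * M"]) (auto simp: M_def)
qed

text \<open>Only continuity at the zero function is extracted, as a bound on a ball of one
  continuous seminorm, evaluated pointwise.\<close>

lemma threeC_space_bound:
  assumes r: "0 < r" and \<Gamma>U: "fundamental_system sU \<Gamma>U" and "threeC_space s T \<Gamma>U B r" and q: "cs q"
  shows "\<exists>p \<delta>. U.cs p \<and> \<delta> > 0 \<and>
    (\<forall>f\<in>C_space r. (\<forall>w\<in>{0..r}. p (f w) < \<delta>) \<longrightarrow> q (gen s T (Psi s T B r f)) < 1)"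
proof -
  have pU: "U.cs p" if "p \<in> \<Gamma>U" for p
    using \<Gamma>U that by (simp add: fundamental_system_def)
  define W where "W = {f \<in> topspace (C_topology r \<Gamma>U). gen s T (Psi s T B r f) \<in> {z. q (z - 0) < 1}}"
  have W: "openin (C_topology r \<Gamma>U) W"
    unfolding W_def using assms(3) open_cs_ball[OF q, of 0 1]
    by (intro openin_continuous_map_preimage[of _ euclidean]) (simp_all add: threeC_space_def)
  \<comment> \<open>The zero of \<open>C_space r\<close> is \<open>undefined\<close> outside
    \<open>[0, r]\<close>, so it is not the constant function.\<close>
  define z where "z = restrict (\<lambda>w. 0 :: 'u) {0..r}"
  have "continuous_on {0..r} z"
    by (rule continuous_on_eq[of _ "\<lambda>w. 0"]) (auto simp: z_def)
  then have "z \<in> C_space r"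
    by (simp add: C_space_def z_def)
  \<comment> \<open>The space underlying a generated topology is the union of its subbasis, so some
    member of \<Gamma>U must exist; dominating the zero seminorm supplies one.\<close>
  have "z \<in> topspace (C_topology r \<Gamma>U)"
  proof -
    have "U.cs (\<lambda>x. 0)"
      by (simp add: continuous_seminorm_def seminorm_def)
    then obtain p where p: "p \<in> \<Gamma>U"
      using \<Gamma>U unfolding fundamental_system_def by blast
    have "sup_seminorm r p (\<lambda>w. z w - z w) < 1"
      using r by (simp add: sup_seminorm_def U.cs_zero[OF pU[OF p]])
    with \<open>z \<in> C_space r\<close> have "z \<in> {g \<in> C_space r. sup_seminorm r p (\<lambda>w. g w - z w) < 1}"
      by simp
    then show ?thesis
      unfolding C_topology_def topology_generated_by_topspace
      by (rule UnionI[rotated], unfold mem_Collect_eq, intro exI[of _ z] exI[of _ p] exI[of _ 1])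
         (simp add: p \<open>z \<in> C_space r\<close>)
  qed
  moreover have "Psi s T B r z = 0"
  proof -
    have "Psi s T B r z = I 0 r (\<lambda>w. 0)"
      unfolding Psi_def convolution_def
      by (intro riemann_integral_cong) (simp add: z_def T_zero)
    also have "\<dots> = 0"
      using I_diff[of 0 r "\<lambda>w. 0" "\<lambda>w. 0"] r by simp
    finally show ?thesis .
  qed
  moreover have "gen s T 0 = 0"
  proof (rule gen_eq)
    show "(diff_quotient s T 0 \<longlongrightarrow> 0) (at_right 0)"
      by (rule Lim_transform_eventually[OF tendsto_const])
         (auto intro!: eventually_at_rightI[of 0 1] simp: diff_quotient_def T_zero)
  qed
  ultimately have "z \<in> W"
    by (simp add: W_def cs_zero[OF q])
  from U.C_topology_nbhd[OF pU W this] obtain p \<delta> where p: "U.cs p" "\<delta> > 0"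
    and sub: "{g \<in> C_space r. \<forall>w\<in>{0..r}. p (g w - z w) < \<delta>} \<subseteq> W"
    by blast
  have "q (gen s T (Psi s T B r f)) < 1" if "f \<in> C_space r" "\<forall>w\<in>{0..r}. p (f w) < \<delta>" for f
  proof -
    have "f \<in> W"
      using sub that by (auto simp: z_def)
    then show ?thesis by (simp add: W_def)
  qed
  with p show ?thesis by blast
qed

section \<open>Continuous approximation of the step function of a semivariation sum\<close>

context
  fixes r :: real and n :: nat and d :: "nat \<Rightarrow> real" and x :: "nat \<Rightarrow> 'u"
  assumes d: "d 0 = 0" "d n = r" "\<And>i. i < n \<Longrightarrow> d i < d (Suc i)"
begin

definition bump :: "real \<Rightarrow> nat \<Rightarrow> real \<Rightarrow> real" where
  "bump h i = trapezoid (r - d (Suc i)) (r - d i) h"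

definition bump_sum :: "real \<Rightarrow> real \<Rightarrow> 'u" where
  "bump_sum h = restrict (\<lambda>w. \<Sum>i<n. sU (of_real (bump h i w)) (x i)) {0..r}"

lemma d_mono: "i \<le> j \<Longrightarrow> j \<le> n \<Longrightarrow> d i \<le> d j"
  by (rule steps_mono[of n d]) (auto intro: less_imp_le d)

lemma bump_sum_in_C_space: "0 < h \<Longrightarrow> bump_sum h \<in> C_space r"
proof -
  assume h: "0 < h"
  have "continuous_on {0..r} (\<lambda>w. \<Sum>i<n. sU (of_real (bump h i w)) (x i))"
    unfolding bump_def
    by (intro U.continuous_on_sum_cs U.continuous_on_scale_cs continuous_on_const continuous_on_of_real
        trapezoid_continuous h)
  then have "continuous_on {0..r} (bump_sum h)"
    by (rule continuous_on_eq) (simp add: bump_sum_def)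
  then show ?thesis
    by (simp add: C_space_def bump_sum_def)
qed

text \<open>All other bumps vanish on this closed interval, the shared end points included, so one
  formula serves the integral over the whole interval.\<close>

lemma bump_sum_eq:
  assumes h: "0 < h" and i: "i < n" and w: "r - d (Suc i) \<le> w" "w \<le> r - d i"
  shows "bump_sum h w = sU (of_real (bump h i w)) (x i)"
proof -
  have "0 \<le> w" "w \<le> r"
    using w d_mono[of 0 i] d_mono[of "Suc i" n] i d by auto
  then have "bump_sum h w = (\<Sum>j<n. sU (of_real (bump h j w)) (x j))"
    by (simp add: bump_sum_def)
  also have "\<dots> = (\<Sum>j<n. if j = i then sU (of_real (bump h i w)) (x i) else 0)"
  proof (intro sum.cong refl)
    fix j assume j: "j \<in> {..<n}"
    have "w \<le> r - d (Suc j)" if "j < i"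
      using w d_mono[of "Suc j" i] that i by simp
    moreover have "r - d j \<le> w" if "i < j"
      using w d_mono[of "Suc i" j] that j by simp
    ultimately have "w \<le> r - d (Suc j) \<or> r - d j \<le> w" if "j \<noteq> i"
      using that by (meson nat_neq_iff)
    then have "bump h j w = 0" if "j \<noteq> i"
      using that h unfolding bump_def by (intro trapezoid_eq_0)
    then show "sU (of_real (bump h j w)) (x j) = (if j = i then sU (of_real (bump h i w)) (x i) else 0)"
      by simp
  qed
  also have "\<dots> = sU (of_real (bump h i w)) (x i)"
    using i by simp
  finally show ?thesis .
qed

text \<open>At most one bump is nonzero at \<open>w\<close> and its factor lies in
  \<open>[0, 1]\<close>, so no factor depending on \<open>n\<close> arises.\<close>

lemma bump_sum_less:
  assumes p: "U.cs p" and \<delta>: "0 < \<delta>" and x: "\<And>i. i < n \<Longrightarrow> p (x i) < \<delta>" and h: "0 < h" and w: "w \<in> {0..r}"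
  shows "p (bump_sum h w) < \<delta>"
proof (cases "\<exists>i<n. bump h i w \<noteq> 0")
  case True
  then obtain i where i: "i < n" "bump h i w \<noteq> 0" by blast
  have "\<not> (w \<le> r - d (Suc i) \<or> r - d i \<le> w)"
    using i(2) trapezoid_eq_0[OF h] unfolding bump_def by blast
  then have "r - d (Suc i) \<le> w" "w \<le> r - d i"
    by linarith+
  then have "p (bump_sum h w) = bump h i w * p (x i)"
    using trapezoid_range(1) by (simp add: bump_sum_eq[OF h i(1)] U.cs_scale[OF p] bump_def)
  also have "\<dots> \<le> 1 * p (x i)"
    unfolding bump_def by (intro mult_right_mono trapezoid_range U.cs_nonneg[OF p])
  finally show ?thesis using x[OF i(1)] by simp
next
  case False
  then have "bump_sum h w = 0"
    using w by (auto simp: bump_sum_def intro!: sum.neutral)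
  with \<delta> show ?thesis by (simp add: U.cs_zero[OF p])
qed

text \<open>On each interval the scalar weight passes through \<open>B\<close> and \<open>T\<close>,
  which leaves finitely many trapezoid-weighted orbit integrals.\<close>

lemma Psi_bump_sum_tendsto:
  "((\<lambda>h. Psi s T B r (bump_sum h)) \<longlongrightarrow>
    (\<Sum>i<n. I (r - d (Suc i)) (r - d i) (\<lambda>u. T (r - u) (B (x i))))) (at_right 0)"
proof -
  have eq: "Psi s T B r (bump_sum h) = (\<Sum>i<n. I (r - d (Suc i)) (r - d i)
      (\<lambda>u. s (of_real (trapezoid (r - d (Suc i)) (r - d i) h u)) (T (r - u) (B (x i)))))"
    if h: "0 < h" for h
  proof -
    have "Psi s T B r (bump_sum h) = (\<Sum>i<n. I (r - d (Suc i)) (r - d i) (\<lambda>u. T (r - u) (B (bump_sum h u))))"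
      unfolding Psi_def convolution_def using d bump_sum_in_C_space[OF h]
      by (intro I_split_reflected T_reflected_continuous B_continuous)
         (auto simp: C_space_def intro: less_imp_le)
    also have "\<dots> = (\<Sum>i<n. I (r - d (Suc i)) (r - d i)
      (\<lambda>u. s (of_real (trapezoid (r - d (Suc i)) (r - d i) h u)) (T (r - u) (B (x i)))))"
    proof (intro sum.cong riemann_integral_cong refl)
      fix i u assume i: "i \<in> {..<n}" and u: "u \<in> {r - d (Suc i)..r - d i}"
      have "0 \<le> r - u"
        using u d_mono[of 0 i] i d(1) by simp
      then show "T (r - u) (B (bump_sum h u)) =
          s (of_real (trapezoid (r - d (Suc i)) (r - d i) h u)) (T (r - u) (B (x i)))"
        using bump_sum_eq[OF h, of i u] i u by (simp add: B_scale T_scale bump_def)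
    qed
    finally show ?thesis .
  qed
  have "((\<lambda>h. \<Sum>i<n. I (r - d (Suc i)) (r - d i)
      (\<lambda>u. s (of_real (trapezoid (r - d (Suc i)) (r - d i) h u)) (T (r - u) (B (x i))))) \<longlongrightarrow>
    (\<Sum>i<n. I (r - d (Suc i)) (r - d i) (\<lambda>u. T (r - u) (B (x i))))) (at_right 0)"
  proof (intro tendsto_sum_cs trapezoid_integral_tendsto T_reflected_orbit_continuous)
    fix i assume "i \<in> {..<n}"
    then show "r - d (Suc i) < r - d i" "r - d i \<le> r"
      using d(3)[of i] d_mono[of 0 i] d(1) by auto
  qed
  then show ?thesis
    by (rule Lim_transform_eventually) (auto intro!: eventually_at_rightI[of 0 1] simp: eq)
qed

end

text \<open>The generator is only closed, so the bound on the continuous approximants is first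
  transferred to the difference quotients, where it survives the limit.\<close>

lemma threeC_imp_bounded_semivariation:
  assumes r: "0 < r" and \<Gamma>X: "fundamental_system s \<Gamma>X" and \<Gamma>U: "fundamental_system sU \<Gamma>U"
    and threeC: "threeC_space s T \<Gamma>U B r"
  shows "bounded_semivariation \<Gamma>X \<Gamma>U (\<lambda>t x. T t (B x)) 0 r"
  unfolding bounded_semivariation_def
proof
  fix q assume "q \<in> \<Gamma>X"
  then have q: "cs q" using \<Gamma>X by (simp add: fundamental_system_def)
  \<comment> \<open>\<open>q'\<close> dominates \<open>q (T t z)\<close> for all
    \<open>t \<le> 1\<close>, so bounding the generator in \<open>q'\<close> bounds all difference
    quotients of step at most \<open>1\<close> in \<open>q\<close>.\<close>
  obtain q' where q': "cs q'" "\<And>t z. 0 \<le> t \<Longrightarrow> t \<le> 1 \<Longrightarrow> q (T t z) \<le> q' z"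
    using equicont[OF q, of 1] by auto
  obtain p \<delta> where p: "U.cs p" and \<delta>: "\<delta> > 0"
    and bound: "\<And>f. f \<in> C_space r \<Longrightarrow> \<forall>w\<in>{0..r}. p (f w) < \<delta> \<Longrightarrow> q' (gen s T (Psi s T B r f)) < 1"
    using threeC_space_bound[OF r \<Gamma>U threeC q'(1)] by blast
  have var: "q (variation_sum n d x) \<le> 1"
    if d: "d 0 = 0" "d n = r" "\<And>i. i < n \<Longrightarrow> d i < d (Suc i)" and x: "\<And>i. i < n \<Longrightarrow> p (x i) < \<delta>" for n d x
  proof -
    define Y where "Y = (\<Sum>i<n. I (r - d (Suc i)) (r - d i) (\<lambda>u. T (r - u) (B (x i))))"
    have "q (diff_quotient s T Y e) \<le> 1" if e: "0 < e" "e \<le> 1" for e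
    proof (rule tendsto_upperbound)
      have "((\<lambda>h. Psi s T B r (bump_sum r n d x h)) \<longlongrightarrow> Y) (at_right 0)"
        unfolding Y_def by (rule Psi_bump_sum_tendsto[OF d])
      then have "((\<lambda>h. diff_quotient s T (Psi s T B r (bump_sum r n d x h)) e) \<longlongrightarrow> diff_quotient s T Y e) (at_right 0)"
        by (rule continuous_linear_tendsto[OF diff_quotient_linear[OF less_imp_le[OF e(1)]]])
      then show "((\<lambda>h. q (diff_quotient s T (Psi s T B r (bump_sum r n d x h)) e)) \<longlongrightarrow> q (diff_quotient s T Y e)) (at_right 0)"
        by (rule tendsto_cs[OF q])
      have "q (diff_quotient s T (Psi s T B r (bump_sum r n d x h)) e) \<le> 1" if h: "0 < h" for h
      proof -
        have f: "bump_sum r n d x h \<in> C_space r"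
          by (rule bump_sum_in_C_space[OF d h])
        have "Psi s T B r (bump_sum r n d x h) \<in> gen_domain s T"
          using threeC f unfolding threeC_space_def endpoint_regularity_def by blast
        then have "q (diff_quotient s T (Psi s T B r (bump_sum r n d x h)) e) \<le> q' (gen s T (Psi s T B r (bump_sum r n d x h)))"
          by (rule diff_quotient_le_gen[OF _ q e q'(2)])
        also have "\<dots> < 1"
          by (rule bound[OF f ballI[OF bump_sum_less[OF d p \<delta> x h]]])
        finally show ?thesis by simp
      qed
      then show "\<forall>\<^sub>F h in at_right 0. q (diff_quotient s T (Psi s T B r (bump_sum r n d x h)) e) \<le> 1"
        by (intro eventually_at_rightI[of 0 1]) auto
    qed simp
    then have ev: "\<forall>\<^sub>F e in at_right 0. q (diff_quotient s T Y e) \<le> 1"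
      by (intro eventually_at_rightI[of 0 1]) auto
    have "((\<lambda>e. q (diff_quotient s T Y e)) \<longlongrightarrow> q (variation_sum n d x)) (at_right 0)"
      unfolding Y_def variation_sum_def using d
      by (intro tendsto_cs[OF q] diff_quotient_step_tendsto) (auto intro: less_imp_le)
    from tendsto_upperbound[OF this ev] show ?thesis
      by simp
  qed
  obtain p0 C where p0: "p0 \<in> \<Gamma>U" "C \<ge> 0" "\<And>x. p x \<le> C * p0 x"
    using \<Gamma>U p unfolding fundamental_system_def by blast
  \<comment> \<open>Scaling by \<open>a\<close> turns \<open>p0 (x i) \<le> 1\<close> into the
    strict bound \<delta> in \<open>p\<close>; undoing it by homogeneity produces the final constant
    \<open>1 / a\<close>.\<close>
  define a where "a = \<delta> / (C + 1)"
  have a: "a > 0" using \<delta> p0(2) by (simp add: a_def)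
  have "q (variation_sum n d x) \<le> 1 / a"
    if d: "d 0 = 0" "d n = r" "\<forall>i<n. d i < d (Suc i)" and x: "\<forall>i<n. p0 (x i) \<le> 1" for n d x
  proof -
    have "p (sU (of_real a) (x i)) < \<delta>" if "i < n" for i
    proof -
      have "p (x i) \<le> C"
        using p0(3)[of "x i"] mult_left_mono[OF x[rule_format, OF that] p0(2)] by simp
      then have "a * p (x i) \<le> a * C"
        using a by simp
      also have "\<dots> < \<delta>"
        using \<delta> p0(2) by (simp add: a_def field_simps)
      finally show ?thesis using a by (simp add: U.cs_scale[OF p])
    qed
    then have "q (variation_sum n d (\<lambda>i. sU (of_real a) (x i))) \<le> 1"
      by (intro var[OF d(1,2) d(3)[rule_format]])
    moreover have "variation_sum n d (\<lambda>i. sU (of_real a) (x i)) = s (of_real a) (variation_sum n d x)"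
      using d by (intro variation_sum_scale) (auto intro: less_imp_le)
    ultimately show ?thesis
      using a by (simp add: cs_scale[OF q] field_simps)
  qed
  note le = this
  have "semivariation q p0 (\<lambda>t x. T t (B x)) 0 r \<le> ereal (1 / a)"
    unfolding semivariation_def variation_sum_def[symmetric]
  proof (rule Sup_least)
    fix z assume "z \<in> {ereal (q (variation_sum n d x)) |n d x.
      d 0 = 0 \<and> d n = r \<and> (\<forall>i<n. d i < d (Suc i)) \<and> (\<forall>i<n. p0 (x i) \<le> 1)}"
    then obtain n d x where "z = ereal (q (variation_sum n d x))"
      "d 0 = 0" "d n = r" "\<forall>i<n. d i < d (Suc i)" "\<forall>i<n. p0 (x i) \<le> 1"
      by blast
    with le show "z \<le> ereal (1 / a)" by simp
  qed
  then have "semivariation q p0 (\<lambda>t x. T t (B x)) 0 r < \<infinity>"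
    by (rule le_less_trans) simp
  then show "\<exists>p\<in>\<Gamma>U. semivariation q p (\<lambda>t x. T t (B x)) 0 r < \<infinity>"
    using p0(1) by blast
qed

end

section \<open>The implications between the four assertions\<close>

theorem theorem4p11:
  fixes r :: real
    and sX :: "'k::real_normed_field \<Rightarrow> 'x::{ab_group_add,t2_space} \<Rightarrow> 'x"
    and sU :: "'k \<Rightarrow> 'u::{ab_group_add,t2_space} \<Rightarrow> 'u"
    and \<Gamma>X :: "('x \<Rightarrow> real) set" and \<Gamma>U :: "('u \<Rightarrow> real) set"
    and T :: "real \<Rightarrow> 'x \<Rightarrow> 'x" and B :: "'u \<Rightarrow> 'x"
  assumes "r > 0"
    and "locally_convex_space sX" and "seq_complete TYPE('x)" and "fundamental_system sX \<Gamma>X"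
    and "operator_semigroup sX T" and "strongly_continuous T" and "locally_equicontinuous \<Gamma>X T"
    and "locally_convex_space sU" and "fundamental_system sU \<Gamma>U"
    and "continuous_linear sU sX B"
  shows "(C_maximal_regularity sX T B r \<longrightarrow> right_continuous_regularity sX T B r) \<and>
         (bounded_semivariation \<Gamma>X \<Gamma>U (\<lambda>t x. T t (B x)) 0 r \<longrightarrow>
            right_continuous_regularity sX T B r) \<and>
         (right_continuous_regularity sX T B r \<longrightarrow> endpoint_regularity sX T B r) \<and>
         (threeC_space sX T \<Gamma>U B r \<longrightarrow>
            (endpoint_regularity sX T B r \<longrightarrow>
             bounded_semivariation \<Gamma>X \<Gamma>U (\<lambda>t x. T t (B x)) 0 r)) \<and>
         ((\<exists>j. invariant_subspace sU sX T j \<and> commuting T j B) \<or> generalised_Schwartz \<Gamma>X \<longrightarrow>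
            (bounded_semivariation \<Gamma>X \<Gamma>U (\<lambda>t x. T t (B x)) 0 r \<longrightarrow>
             C_maximal_regularity sX T B r))"
proof -
  interpret X: lcs sX
    using assms(2) by (simp add: lcs_iff)
  interpret lcs_convolution sX T sU B
  proof unfold_locales
    \<comment> \<open>Local equicontinuity is given for \<Gamma>X only. A general \<open>q\<close>
      is first dominated by a member of \<Gamma>X, and both constants are then absorbed into the new
      seminorm.\<close>
    show "\<exists>p. X.cs p \<and> (\<forall>t x. 0 \<le> t \<longrightarrow> t \<le> t0 \<longrightarrow> q (T t x) \<le> p x)" if q: "X.cs q" and t0: "0 \<le> t0" for q t0
    proof -
      obtain q0 C where q0: "q0 \<in> \<Gamma>X" "C \<ge> 0" "\<And>x. q x \<le> C * q0 x"
        using assms(4) q unfolding fundamental_system_def by blast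
      obtain p D where p: "p \<in> \<Gamma>X" "D \<ge> 0" "\<And>t x. t \<in> {0..t0} \<Longrightarrow> q0 (T t x) \<le> D * p x"
        using assms(7) q0(1) t0 unfolding locally_equicontinuous_def by blast
      have "X.cs p" using p(1) assms(4) by (simp add: fundamental_system_def)
      then have "X.cs (\<lambda>x. C * D * p x)"
        using q0(2) p(2) by (intro X.cs_cmult) auto
      moreover have "q (T t x) \<le> C * D * p x" if "0 \<le> t" "t \<le> t0" for t x
        using order_trans[OF q0(3) mult_left_mono[OF p(3) q0(2)], of t x] that by (simp add: mult.assoc)
      ultimately show ?thesis by blast
    qed
  qed (use assms in \<open>auto simp: locally_convex_space_def vector_space_def\<close>)
  have ab: "right_continuous_regularity sX T B r" if "C_maximal_regularity sX T B r"
    unfolding right_continuous_regularity_def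
  proof (intro ballI conjI)
    fix f :: "real \<Rightarrow> 'u" and t assume f: "f \<in> C_space r" and t: "t \<in> {0..r}"
    show "convolution sX T (\<lambda>s. B (f s)) t \<in> gen_domain sX T"
      using that f t by (simp add: C_maximal_regularity_def)
    have "continuous_on {0..r} (\<lambda>t. gen sX T (convolution sX T (\<lambda>s. B (f s)) t))"
      using that f by (simp add: C_maximal_regularity_def)
    then have "continuous_on {t..r} (\<lambda>t. gen sX T (convolution sX T (\<lambda>s. B (f s)) t))"
      using t by (elim continuous_on_subset) auto
    then show "continuous (at t within {t..r}) (\<lambda>t. gen sX T (convolution sX T (\<lambda>s. B (f s)) t))"
      using t by (simp add: continuous_on_eq_continuous_within)
  qed
  have bc: "endpoint_regularity sX T B r" if "right_continuous_regularity sX T B r"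
    using that assms(1) by (simp add: endpoint_regularity_def right_continuous_regularity_def Psi_def)
  have da: "C_maximal_regularity sX T B r" if "bounded_semivariation \<Gamma>X \<Gamma>U (\<lambda>t x. T t (B x)) 0 r"
    using bounded_semivariation_imp_variation_bounded[OF assms(4,9) that]
    by (rule C_maximal_regularityI[OF assms(1)])
  show ?thesis
    using ab bc da threeC_imp_bounded_semivariation[OF assms(1,4,9)] by blast
qed

end
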